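(* It is decidable whether a fully-typed relational to RDF data exchange setting $\mathcal{E} = (\mathbf{R}, \mathbf{S}, \Sigma_{\mathrm{st}}, \mathcal{F}, F_{\mathrm{int}})$ is key-covered.
   Context: **Domain.** $\mathbf{Dom}$ is a fixed infinite enumerable set partitioned into three infinite sets $\mathbf{Dom} = \mathbf{Iri}\cup\mathbf{Lit}\cup\mathbf{Blank}$ (IRIs, literals, blank nodes). $\mathbf{NullLit}\subseteq\mathbf{Lit}$ is an infinite subset of null literals. **Source schema.** A relational schema is $\mathbf{R}=(\mathcal{R},\Sigma_{\mathrm{fd}})$ where $\mathcal{R}$ is a finite set of relation symbols with arities and $\Sigma_{\mathrm{fd}}$ is a set of functional dependencies $R:X\to Y$, with $R\in\mathcal{R}$ of arity $n$ and $X,Y\subseteq\{1,\dots,n\}$, meaning $\forall \mathbf{x},\mathbf{y}.\ R(\mathbf{x})\wedge R(\mathbf{y})\wedge\bigwedge_{i\in X}x_i=y_i\Rightarrow\bigwedge_{j\in Y}x_j=y_j$. An instance $I$ of $\mathbf{R}$ assigns to each $R\in\mathcal R$ of arity $n$ a relation $R^I\subseteq\mathbf{Dom}^n$; only instances all of whose values are in $\mathbf{Lit}\setminus\mathbf{NullLit}$ are considered. $I$ is valid if $I\models\Sigma_{\mathrm{fd}}$. **Target schema.** A ShEx schema is $\mathbf{S}=(\mathcal{T},\delta)$ where $\mathcal{T}$ is a finite set of shape names (types) and $\delta$ maps each $T\in\mathcal{T}$ to a finite set of triple constraints $p::S^\mu$ with $p\in\mathbf{Iri}$, $S\in\mathcal{T}\cup\{\mathit{Lit}\}$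 ($\mathit{Lit}$ a reserved symbol), $\mu\in\{1,?,*,+\}$ (exactly one, at most one, any number, at least one), such that for each $T$ and $p$, $\delta(T)$ contains at most one triple constraint using $p$. The target signature is $\mathcal{G}_{\mathcal T}=\{\mathit{Triple}\}\cup\mathcal{T}\cup\{\mathit{Lit}\}$, with $\mathit{Triple}$ ternary and the other symbols unary. **Data exchange setting.** $\mathcal{E}=(\mathbf{R},\mathbf{S},\Sigma_{\mathrm{st}},\mathcal{F},F_{\mathrm{int}})$ where $\mathbf{R}=(\mathcal{R},\Sigma_{\mathrm{fd}})$ is a relational schema, $\mathbf{S}=(\mathcal{T},\delta)$ is a ShEx schema, $\mathcal{F}$ is a finite set of function symbols (IRI constructors) with arities, $F_{\mathrm{int}}$ interprets each $f\in\mathcal{F}$ of arity $n$ as a function $\mathbf{Dom}^n\to\mathbf{Iri}$, and $\Sigma_{\mathrm{st}}$ is a set of source-to-target tuple generating dependencies (st-tgds) $\forall\mathbf{x}.\ \varphi\Rightarrow\psi$, with $\varphi$ a conjunction of atomic formulas over $\mathcal{R}$ and $\psi$ a conjunction of atomic formulas over $\mathcal{G}_{\mathcal T}\cup\mathcal{F}$ (function terms are not nested). The interpretations of distinct function symbols have disjoint ranges. **Fully-typed.** $\mathcal{E}$ is fully-typed if every st-tgd has the form $\forall\mathbf{x}.\ \varphi\Rightarrow\mathit{Triple}(s,p,o)\wedge T_s(s)\wedge T_o(o)$ where: $p\in\mathbf{Iri}$; $s=f(\mathbf{y})$ with $f\in\mathcal{F}$, $\mathbf{y}\subseteq\mathbf{x}$,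 and $T_s\in\mathcal{T}$; either $o=g(\mathbf{z})$ with $g\in\mathcal{F}$, $\mathbf{z}\subseteq\mathbf{x}$, and $T_o\in\mathcal{T}$, or $o=z$ is a variable of $\mathbf{x}$ and $T_o=\mathit{Lit}$; moreover $p::T_o^\mu\in\delta(T_s)$ for some multiplicity $\mu$; and every $f\in\mathcal{F}$ is used with a unique type in $\mathcal{T}$. **Key-covered.** Let $\mathcal{E}$ be fully-typed. Two (not necessarily distinct) st-tgds are contentious if both use the same $f\in\mathcal{F}$ for their subjects and have the same predicate $p$ (hence the same subject type $T_s$ and object type $T_o$), and $p::T_o^\mu\in\delta(T_s)$ with $\mu\in\{1,?\}$. Write two contentious st-tgds, with pairwise disjoint variables, as $\sigma_i=\forall\mathbf{x}_i,\mathbf{y}_i.\ \varphi_i(\mathbf{x}_i,\mathbf{y}_i)\Rightarrow\mathit{Triple}(f(\mathbf{x}_i),p,o_i)\wedge T_s(f(\mathbf{x}_i))\wedge T_o(o_i)$, $i=1,2$ (for a st-tgd paired with itself, take two renamed copies). They are functionally overlapping if for every valid instance $I$ of $\mathbf{R}$, $I\cup F_{\mathrm{int}}\models\forall\mathbf{x}_1,\mathbf{y}_1,\mathbf{x}_2,\mathbf{y}_2.\ \varphi_1(\mathbf{x}_1,\mathbf{y}_1)\wedge\varphi_2(\mathbf{x}_2,\mathbf{y}_2)\wedge\mathbf{x}_1=\mathbf{x}_2\Rightarrow o_1=o_2$. $\mathcal{E}$ is key-covered if every pair of its contentious st-tgds is functionally overlapping.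
   Formalization: F_int has no finite representation, so it cannot be part of an algorithm's input. Decidability is shown for each fixed choice of F and F_int, uniformly in R, S and Sigma_st; one algorithm for all settings, F and F_int included, is given only when the IRI constructors are injective. *)

theory Defs
  imports Main "HOL-Library.Nat_Bijection"
begin

section \<open>Domain\<close>

text \<open>The set Dom is the carrier type \<open>'d\<close>. Relation symbols, shape names, function symbols and
  variables are natural numbers.\<close>

record 'd rdf_domain =
  Iri :: "'d set"
  Lit :: "'d set"
  Blank :: "'d set"
  NullLit :: "'d set"

definition rdf_domain :: "'d rdf_domain \<Rightarrow> bool" where
  "rdf_domain D \<longleftrightarrow>
     Iri D \<union> Lit D \<union> Blank D = UNIV \<and>
     Iri D \<inter> Lit D = {} \<and> Iri D \<inter> Blank D = {} \<and> Lit D \<inter> Blank D = {} \<and>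
     infinite (Iri D) \<and> infinite (Lit D) \<and> infinite (Blank D) \<and>
     NullLit D \<subseteq> Lit D \<and> infinite (NullLit D)"


section \<open>Relational schemas\<close>

text \<open>\<open>(R, X, Y) \<in> fds S\<close> is the functional dependency \<open>R : X \<rightarrow> Y\<close>. Positions of an
  \<open>n\<close>-ary symbol are numbered from \<open>0\<close> to \<open>n - 1\<close>. The value of \<open>rarity\<close> outside \<open>rsyms\<close> is
  irrelevant.\<close>

record rel_schema =
  rsyms :: "nat set"
  rarity :: "nat \<Rightarrow> nat"
  fds :: "(nat \<times> nat set \<times> nat set) set"

definition wf_rel_schema :: "rel_schema \<Rightarrow> bool" where
  "wf_rel_schema S \<longleftrightarrow>
     finite (rsyms S) \<and>
     (\<forall>(R, X, Y) \<in> fds S. R \<in> rsyms S \<and> X \<subseteq> {..<rarity S R} \<and> Y \<subseteq> {..<rarity S R})"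

type_synonym 'd inst = "nat \<Rightarrow> 'd list set"

definition is_instance :: "'d rdf_domain \<Rightarrow> rel_schema \<Rightarrow> 'd inst \<Rightarrow> bool" where
  "is_instance D S I \<longleftrightarrow>
     (\<forall>R \<in> rsyms S. \<forall>t \<in> I R. length t = rarity S R \<and> set t \<subseteq> Lit D - NullLit D)"

definition satisfies_fd :: "'d inst \<Rightarrow> nat \<times> nat set \<times> nat set \<Rightarrow> bool" where
  "satisfies_fd I = (\<lambda>(R, X, Y).
     \<forall>t \<in> I R. \<forall>u \<in> I R. (\<forall>i \<in> X. t ! i = u ! i) \<longrightarrow> (\<forall>j \<in> Y. t ! j = u ! j))"

definition valid_instance :: "'d rdf_domain \<Rightarrow> rel_schema \<Rightarrow> 'd inst \<Rightarrow> bool" where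
  "valid_instance D S I \<longleftrightarrow> is_instance D S I \<and> (\<forall>d \<in> fds S. satisfies_fd I d)"


section \<open>ShEx schemas\<close>

datatype mult = One | Opt | Star | Plus

text \<open>\<open>LitSym\<close> is the reserved symbol \<open>Lit\<close>.\<close>

datatype shape = Shape nat | LitSym

datatype 'd triple_constraint = TC (tc_pred: 'd) (tc_shape: shape) (tc_mult: mult)

record 'd shex_schema =
  types :: "nat set"
  delta :: "nat \<Rightarrow> 'd triple_constraint set"

definition shapes :: "'d shex_schema \<Rightarrow> shape set" where
  "shapes S = insert LitSym (Shape ` types S)"

definition wf_shex_schema :: "'d rdf_domain \<Rightarrow> 'd shex_schema \<Rightarrow> bool" where
  "wf_shex_schema D S \<longleftrightarrow>
     finite (types S) \<and>
     (\<forall>T \<in> types S.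
        finite (delta S T) \<and>
        (\<forall>c \<in> delta S T. tc_pred c \<in> Iri D \<and> tc_shape c \<in> shapes S) \<and>
        (\<forall>c \<in> delta S T. \<forall>c' \<in> delta S T. tc_pred c = tc_pred c' \<longrightarrow> c = c'))"


section \<open>IRI constructors\<close>

record 'd iri_constructors =
  fsyms :: "nat set"
  farity :: "nat \<Rightarrow> nat"
  Fint :: "nat \<Rightarrow> 'd list \<Rightarrow> 'd"

definition wf_iri_constructors :: "'d rdf_domain \<Rightarrow> 'd iri_constructors \<Rightarrow> bool" where
  "wf_iri_constructors D C \<longleftrightarrow>
     finite (fsyms C) \<and>
     (\<forall>f \<in> fsyms C. \<forall>t. length t = farity C f \<longrightarrow> Fint C f t \<in> Iri D) \<and>
     (\<forall>f \<in> fsyms C. \<forall>g \<in> fsyms C. f \<noteq> g \<longrightarrow>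
        Fint C f ` {t. length t = farity C f} \<inter> Fint C g ` {t. length t = farity C g} = {})"

definition injective_iri_constructors :: "'d iri_constructors \<Rightarrow> bool" where
  "injective_iri_constructors C \<longleftrightarrow>
     (\<forall>f \<in> fsyms C. inj_on (Fint C f) {t. length t = farity C f})"


section \<open>Source-to-target tuple generating dependencies\<close>

text \<open>Function terms \<open>App f xs\<close> are applied to variables only, hence are not nested. A source atom
  \<open>(R, xs)\<close> is the relational atom \<open>R(xs)\<close>.\<close>

datatype 'd trm = Var nat | Const 'd | App nat "nat list"

fun trm_vars :: "'d trm \<Rightarrow> nat set" where
  "trm_vars (Var x) = {x}"
| "trm_vars (Const c) = {}"
| "trm_vars (App f xs) = set xs"

datatype 'd target_atom = Triple "'d trm" "'d trm" "'d trm" | Typed shape "'d trm"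

fun atom_trms :: "'d target_atom \<Rightarrow> 'd trm set" where
  "atom_trms (Triple s p ob) = {s, p, ob}"
| "atom_trms (Typed T t) = {t}"

text \<open>\<open>Tgd \<phi> \<psi>\<close> is \<open>\<forall>x. \<phi> \<Rightarrow> \<psi>\<close>, where \<open>x\<close> consists of the variables that occur in the
  conjunction \<open>\<phi>\<close>.\<close>

datatype 'd tgd = Tgd (body: "(nat \<times> nat list) list") (head: "'d target_atom list")

definition body_vars :: "(nat \<times> nat list) list \<Rightarrow> nat set" where
  "body_vars \<phi> = (\<Union>(R, xs) \<in> set \<phi>. set xs)"

definition wf_trm :: "'d iri_constructors \<Rightarrow> 'd trm \<Rightarrow> bool" where
  "wf_trm C t \<longleftrightarrow> (\<forall>f xs. t = App f xs \<longrightarrow> f \<in> fsyms C \<and> length xs = farity C f)"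

definition wf_tgd :: "rel_schema \<Rightarrow> 'd shex_schema \<Rightarrow> 'd iri_constructors \<Rightarrow> 'd tgd \<Rightarrow> bool" where
  "wf_tgd R S C \<sigma> \<longleftrightarrow>
     (\<forall>(r, xs) \<in> set (body \<sigma>). r \<in> rsyms R \<and> length xs = rarity R r) \<and>
     (\<forall>a \<in> set (head \<sigma>). \<forall>t \<in> atom_trms a. wf_trm C t \<and> trm_vars t \<subseteq> body_vars (body \<sigma>)) \<and>
     (\<forall>T t. Typed T t \<in> set (head \<sigma>) \<longrightarrow> T \<in> shapes S)"


section \<open>Data exchange settings\<close>

record 'd setting =
  rel :: rel_schema
  shex :: "'d shex_schema"
  tgds :: "'d tgd set"
  constructors :: "'d iri_constructors"

definition data_exchange_setting :: "'d rdf_domain \<Rightarrow> 'd setting \<Rightarrow> bool" where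
  "data_exchange_setting D E \<longleftrightarrow>
     wf_rel_schema (rel E) \<and> wf_shex_schema D (shex E) \<and>
     wf_iri_constructors D (constructors E) \<and>
     finite (tgds E) \<and> (\<forall>\<sigma> \<in> tgds E. wf_tgd (rel E) (shex E) (constructors E) \<sigma>)"

text \<open>The head \<open>Triple(f(xs), p, ob) \<and> Ts(f(xs)) \<and> To(ob)\<close>.\<close>

definition typed_head ::
  "nat \<Rightarrow> nat list \<Rightarrow> 'd \<Rightarrow> 'd trm \<Rightarrow> nat \<Rightarrow> shape \<Rightarrow> 'd target_atom list" where
  "typed_head f xs p ob Ts To =
     [Triple (App f xs) (Const p) ob, Typed (Shape Ts) (App f xs), Typed To ob]"

text \<open>That function symbols, types and variables in heads are those of the setting is part of
  \<open>data_exchange_setting\<close>.\<close>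

definition fully_typed :: "'d rdf_domain \<Rightarrow> 'd setting \<Rightarrow> bool" where
  "fully_typed D E \<longleftrightarrow>
     data_exchange_setting D E \<and>
     (\<forall>\<sigma> \<in> tgds E. \<exists>f xs p ob Ts To.
        head \<sigma> = typed_head f xs p ob Ts To \<and> p \<in> Iri D \<and>
        ((\<exists>g zs T. ob = App g zs \<and> To = Shape T) \<or> (\<exists>z. ob = Var z \<and> To = LitSym)) \<and>
        (\<exists>\<mu>. TC p To \<mu> \<in> delta (shex E) Ts)) \<and>
     (\<forall>\<sigma> \<in> tgds E. \<forall>\<sigma>' \<in> tgds E. \<forall>f xs xs' T T'.
        Typed T (App f xs) \<in> set (head \<sigma>) \<longrightarrow> Typed T' (App f xs') \<in> set (head \<sigma>') \<longrightarrow> T = T')"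


section \<open>Key coverage\<close>

fun eval_trm :: "(nat \<Rightarrow> 'd list \<Rightarrow> 'd) \<Rightarrow> (nat \<Rightarrow> 'd) \<Rightarrow> 'd trm \<Rightarrow> 'd" where
  "eval_trm J v (Var x) = v x"
| "eval_trm J v (Const c) = c"
| "eval_trm J v (App f xs) = J f (map v xs)"

definition sat_body :: "'d inst \<Rightarrow> (nat \<Rightarrow> 'd) \<Rightarrow> (nat \<times> nat list) list \<Rightarrow> bool" where
  "sat_body I v \<phi> \<longleftrightarrow> (\<forall>(R, xs) \<in> set \<phi>. map v xs \<in> I R)"

definition contentious :: "'d setting \<Rightarrow> 'd tgd \<Rightarrow> 'd tgd \<Rightarrow> bool" where
  "contentious E \<sigma>\<^sub>1 \<sigma>\<^sub>2 \<longleftrightarrow>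
     (\<exists>f xs\<^sub>1 xs\<^sub>2 p o\<^sub>1 o\<^sub>2 Ts To \<mu>.
        head \<sigma>\<^sub>1 = typed_head f xs\<^sub>1 p o\<^sub>1 Ts To \<and>
        head \<sigma>\<^sub>2 = typed_head f xs\<^sub>2 p o\<^sub>2 Ts To \<and>
        TC p To \<mu> \<in> delta (shex E) Ts \<and> \<mu> \<in> {One, Opt})"

text \<open>The two dependencies are evaluated under independent valuations \<open>v\<^sub>1\<close> and \<open>v\<^sub>2\<close>, which
  amounts to renaming their variables apart (also when \<open>\<sigma>\<^sub>1 = \<sigma>\<^sub>2\<close>).\<close>

definition functionally_overlapping ::
  "'d rdf_domain \<Rightarrow> 'd setting \<Rightarrow> 'd tgd \<Rightarrow> 'd tgd \<Rightarrow> bool" where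
  "functionally_overlapping D E \<sigma>\<^sub>1 \<sigma>\<^sub>2 \<longleftrightarrow>
     (\<forall>f xs\<^sub>1 xs\<^sub>2 p o\<^sub>1 o\<^sub>2 Ts To.
        head \<sigma>\<^sub>1 = typed_head f xs\<^sub>1 p o\<^sub>1 Ts To \<longrightarrow> head \<sigma>\<^sub>2 = typed_head f xs\<^sub>2 p o\<^sub>2 Ts To \<longrightarrow>
        (\<forall>I. valid_instance D (rel E) I \<longrightarrow>
           (\<forall>v\<^sub>1 v\<^sub>2. sat_body I v\<^sub>1 (body \<sigma>\<^sub>1) \<and> sat_body I v\<^sub>2 (body \<sigma>\<^sub>2) \<and>
              map v\<^sub>1 xs\<^sub>1 = map v\<^sub>2 xs\<^sub>2 \<longrightarrow>
              eval_trm (Fint (constructors E)) v\<^sub>1 o\<^sub>1 = eval_trm (Fint (constructors E)) v\<^sub>2 o\<^sub>2)))"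

definition key_covered :: "'d rdf_domain \<Rightarrow> 'd setting \<Rightarrow> bool" where
  "key_covered D E \<longleftrightarrow>
     (\<forall>\<sigma>\<^sub>1 \<in> tgds E. \<forall>\<sigma>\<^sub>2 \<in> tgds E.
        contentious E \<sigma>\<^sub>1 \<sigma>\<^sub>2 \<longrightarrow> functionally_overlapping D E \<sigma>\<^sub>1 \<sigma>\<^sub>2)"


section \<open>Decidability\<close>

text \<open>Kleene's total recursive functions: \<open>recursive n f\<close> concerns the values of \<open>f\<close> on lists of
  length \<open>n\<close>. Minimization is restricted to regular functions, so all functions are total.\<close>

inductive recursive :: "nat \<Rightarrow> (nat list \<Rightarrow> nat) \<Rightarrow> bool" where
  zero: "recursive n (\<lambda>xs. 0)"
| succ: "recursive 1 (\<lambda>xs. Suc (xs ! 0))"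
| proj: "i < n \<Longrightarrow> recursive n (\<lambda>xs. xs ! i)"
| comp: "recursive (length gs) f \<Longrightarrow> \<forall>g \<in> set gs. recursive n g \<Longrightarrow>
    recursive n (\<lambda>xs. f (map (\<lambda>g. g xs) gs))"
| prim: "recursive n f \<Longrightarrow> recursive (Suc (Suc n)) g \<Longrightarrow>
    recursive (Suc n) (\<lambda>xs. rec_nat (f (tl xs)) (\<lambda>k r. g (k # r # tl xs)) (hd xs))"
| mu: "recursive (Suc n) f \<Longrightarrow> \<forall>xs. length xs = n \<longrightarrow> (\<exists>k. f (k # xs) = 0) \<Longrightarrow>
    recursive n (\<lambda>xs. LEAST k. f (k # xs) = 0)"

text \<open>Decidability of the problem: given (the code of) an input \<open>x \<in> A\<close>, does \<open>P x\<close> hold?\<close>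

definition decidable_on :: "('a \<Rightarrow> nat) \<Rightarrow> 'a set \<Rightarrow> ('a \<Rightarrow> bool) \<Rightarrow> bool" where
  "decidable_on code A P \<longleftrightarrow>
     (\<exists>d. recursive 1 d \<and> (\<forall>x \<in> A. d [code x] = (if P x then 1 else 0)))"


section \<open>Encoding of settings\<close>

text \<open>An effective encoding of the finite data of a setting, relative to an enumeration \<open>e\<close> of the
  domain. All its ingredients are the explicit bijections of \<open>Nat_Bijection\<close>; finite
  sets of numbers are encoded by their binary representation, and a finite map by its graph.
  The functions \<open>Fint\<close> are infinite objects and are not part of the code.\<close>

definition code_map :: "nat set \<Rightarrow> (nat \<Rightarrow> nat) \<Rightarrow> nat" where
  "code_map A h = set_encode ((\<lambda>x. prod_encode (x, h x)) ` A)"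

definition code_fd :: "nat \<times> nat set \<times> nat set \<Rightarrow> nat" where
  "code_fd = (\<lambda>(R, X, Y). prod_encode (R, prod_encode (set_encode X, set_encode Y)))"

definition code_rel_schema :: "rel_schema \<Rightarrow> nat" where
  "code_rel_schema S =
     prod_encode (code_map (rsyms S) (rarity S), set_encode (code_fd ` fds S))"

fun code_mult :: "mult \<Rightarrow> nat" where
  "code_mult One = 0"
| "code_mult Opt = 1"
| "code_mult Star = 2"
| "code_mult Plus = 3"

fun code_shape :: "shape \<Rightarrow> nat" where
  "code_shape LitSym = 0"
| "code_shape (Shape T) = Suc T"

fun code_triple_constraint :: "('d \<Rightarrow> nat) \<Rightarrow> 'd triple_constraint \<Rightarrow> nat" where
  "code_triple_constraint e (TC p S \<mu>) = list_encode [e p, code_shape S, code_mult \<mu>]"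

definition code_shex_schema :: "('d \<Rightarrow> nat) \<Rightarrow> 'd shex_schema \<Rightarrow> nat" where
  "code_shex_schema e S =
     code_map (types S) (\<lambda>T. set_encode (code_triple_constraint e ` delta S T))"

fun code_trm :: "('d \<Rightarrow> nat) \<Rightarrow> 'd trm \<Rightarrow> nat" where
  "code_trm e (Var x) = list_encode [0, x]"
| "code_trm e (Const c) = list_encode [1, e c]"
| "code_trm e (App f xs) = list_encode [2, f, list_encode xs]"

fun code_target_atom :: "('d \<Rightarrow> nat) \<Rightarrow> 'd target_atom \<Rightarrow> nat" where
  "code_target_atom e (Triple s p ob) = list_encode [0, code_trm e s, code_trm e p, code_trm e ob]"
| "code_target_atom e (Typed T t) = list_encode [1, code_shape T, code_trm e t]"

fun code_tgd :: "('d \<Rightarrow> nat) \<Rightarrow> 'd tgd \<Rightarrow> nat" where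
  "code_tgd e (Tgd \<phi> \<psi>) = prod_encode
     (list_encode (map (\<lambda>(R, xs). prod_encode (R, list_encode xs)) \<phi>),
      list_encode (map (code_target_atom e) \<psi>))"

definition code_setting :: "('d \<Rightarrow> nat) \<Rightarrow> 'd setting \<Rightarrow> nat" where
  "code_setting e E = list_encode
     [code_rel_schema (rel E), code_shex_schema e (shex E), set_encode (code_tgd e ` tgds E),
      code_map (fsyms (constructors E)) (farity (constructors E))]"

end

theory Submission
  imports Defs
begin

text \<open>Functional dependencies only speak about equalities, so whether a pair of valuations of two
  bodies extends to a valid instance depends only on the kernel of the pair, and every kernel is
  realized by labels from a finite set whose size is bounded by the number of variables. It therefore
  suffices to test all valuations by labels below such a bound: one checks that the image of the
  bodies satisfies the dependencies (it is then itself a valid instance), that the subjects agree,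
  and that the objects agree for every interpretation of the labels by distinct constants. Distinct
  constructors have disjoint ranges, and for an injective constructor the last test is equality of the
  argument tuples. For a fixed but arbitrary interpretation of the constructors, the outcome depends
  only on the constructor and on the kernel of the concatenation of both argument tuples; there are
  finitely many such kernels, so the answers form a finite table that is built into the decision
  procedure.\<close>

section \<open>Computable functions and predicates\<close>

text \<open>Since \<open>Fint\<close> is not part of the code, settings with equal codes may have
  different answers, so no single procedure for all fully typed settings can be asked for. The two
  halves of the theorem avoid this differently: for a fixed \<open>C\<close> the program may depend
  on \<open>C\<close>, so facts about it may be hard-wired without being computed; for injective
  constructors the answer does not depend on \<open>Fint\<close>, and one program serves them all.
  The domain is treated in the same way: whether \<open>constants D\<close> is finite, and its
  cardinality, are constants of the program. They matter because a labelling with too many labels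
  has no interpretation, and a test on it could wrongly refute an overlap; such labellings are
  filtered out before objects are compared.\<close>

text \<open>The arguments of a function are read from an environment \<open>e\<close>, of which only an initial
  segment is used. A binder \<open>k\<close> is added as the new variable \<open>0\<close>, so that \<open>\<lambda>e. Q k e\<close> becomes
  \<open>\<lambda>e. Q (e 0) (\<lambda>i. e (Suc i))\<close>; hence no rule has a side condition on arities.\<close>

definition computable :: "((nat \<Rightarrow> nat) \<Rightarrow> nat) \<Rightarrow> bool" where
  "computable F \<longleftrightarrow> (\<exists>n g. recursive n g \<and> (\<forall>e. F e = g (map e [0..<n])))"

named_theorems comp_intro

text \<open>Composition with the first \<open>n\<close> projections discards surplus arguments, so
  functions of different arities can be brought to a common one before they are combined.\<close>

lemma computable_arity:
  assumes "computable F"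
  shows "\<exists>n. \<forall>m\<ge>n. \<exists>g. recursive m g \<and> (\<forall>e. F e = g (map e [0..<m]))"
proof -
  obtain n g where g: "recursive n g" "\<And>e. F e = g (map e [0..<n])"
    using assms unfolding computable_def by blast
  have "\<exists>h. recursive m h \<and> (\<forall>e. F e = h (map e [0..<m]))" if "n \<le> m" for m
  proof (intro exI conjI allI)
    let ?gs = "map (\<lambda>i (xs :: nat list). xs ! i) [0..<n]"
    show "recursive m (\<lambda>xs. g (map (\<lambda>h. h xs) ?gs))"
      using g(1) that by (intro recursive.comp) (auto intro: recursive.proj)
    show "F e = g (map (\<lambda>h. h (map e [0..<m])) ?gs)" for e
      using that by (auto simp: g(2) intro!: arg_cong[where f = g])
  qed
  then show ?thesis by blast
qed

lemma map_case_nat_upt: "map (case_nat k e) [0..<Suc n] = k # map e [0..<n]"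
  by (simp add: upt_conv_Cons map_Suc_upt[symmetric] del: upt_Suc)

lemma computable_var [comp_intro]: "computable (\<lambda>e. e i)"
  unfolding computable_def
  by (intro exI[of _ "Suc i"] exI[of _ "\<lambda>xs. xs ! i"]) (auto intro!: recursive.proj simp del: upt_Suc)

text \<open>\<open>F\<close> reads only finitely many variables, so although \<open>G\<close> is an
  infinite family, only finitely many of its members enter one application of
  \<open>recursive.comp\<close>.\<close>

lemma computable_subst:
  assumes F: "computable F" and G: "\<And>i. computable (G i)"
  shows "computable (\<lambda>e. F (\<lambda>i. G i e))"
proof -
  obtain n f where f: "recursive n f" "\<And>e. F e = f (map e [0..<n])"
    using F unfolding computable_def by blast
  obtain N where N: "\<And>i m. N i \<le> m \<Longrightarrow> \<exists>g. recursive m g \<and> (\<forall>e. G i e = g (map e [0..<m]))"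
    using computable_arity[OF G] by metis
  define m where "m = (\<Sum>i<n. N i)"
  have "N i \<le> m" if "i < n" for i
    using that unfolding m_def by (auto intro: member_le_sum)
  then have "\<forall>i. \<exists>g. i < n \<longrightarrow> recursive m g \<and> (\<forall>e. G i e = g (map e [0..<m]))"
    using N by blast
  then obtain h where h: "\<And>i. i < n \<Longrightarrow> recursive m (h i)"
      "\<And>i e. i < n \<Longrightarrow> G i e = h i (map e [0..<m])"
    by metis
  have "recursive m (\<lambda>xs. f (map (\<lambda>g. g xs) (map h [0..<n])))"
    using f(1) h(1) by (intro recursive.comp) auto
  moreover have "F (\<lambda>i. G i e) = f (map (\<lambda>g. g (map e [0..<m])) (map h [0..<n]))" for e
    using h(2) by (auto simp: f(2) intro!: arg_cong[where f = f])
  ultimately show ?thesis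
    unfolding computable_def by blast
qed

lemma computable_shift: "computable F \<Longrightarrow> computable (\<lambda>e. F (\<lambda>i. e (Suc i)))"
  using computable_subst[of F "\<lambda>i e. e (Suc i)"] computable_var by blast

lemma computable_1:
  assumes "computable (\<lambda>e. f (e 0))" "computable A"
  shows "computable (\<lambda>e. f (A e))"
  using computable_subst[OF assms(1), of "\<lambda>_. A"] assms(2) by simp

lemma computable_2:
  assumes "computable (\<lambda>e. f (e 0) (e 1))" "computable A" "computable B"
  shows "computable (\<lambda>e. f (A e) (B e))"
  using computable_subst[OF assms(1), of "\<lambda>i. if i = 0 then A else B"] assms by simp

lemma computable_Suc [comp_intro]: "computable A \<Longrightarrow> computable (\<lambda>e. Suc (A e))"
proof (rule computable_1[of Suc])
  show "computable (\<lambda>e. Suc (e 0))"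
    unfolding computable_def
    by (intro exI[of _ 1] exI[of _ "\<lambda>xs. Suc (xs ! 0)"]) (auto intro: recursive.succ[simplified])
qed

lemma computable_const [comp_intro]: "computable (\<lambda>e. c)"
proof (induction c)
  case 0
  show ?case
    unfolding computable_def
    by (intro exI[of _ 0] exI[of _ "\<lambda>xs. 0"]) (auto intro: recursive.zero)
qed (rule computable_Suc)

lemma computable_rec [comp_intro]:
  assumes A: "computable A" and G: "computable (\<lambda>e. G (e 0) (e (Suc 0)) (\<lambda>i. e (Suc (Suc i))))"
    and N: "computable N"
  shows "computable (\<lambda>e. rec_nat (A e) (\<lambda>k r. G k r e) (N e))"
proof -
  obtain n1 where n1: "\<And>m. m \<ge> n1 \<Longrightarrow> \<exists>g. recursive m g \<and> (\<forall>e. A e = g (map e [0..<m]))"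
    using computable_arity[OF A] by blast
  obtain n2 where n2: "\<And>m. m \<ge> n2 \<Longrightarrow> \<exists>g. recursive m g \<and>
      (\<forall>e. G (e 0) (e (Suc 0)) (\<lambda>i. e (Suc (Suc i))) = g (map e [0..<m]))"
    using computable_arity[OF G] by blast
  define m where "m = n1 + n2"
  obtain a where a: "recursive m a" "\<And>e. A e = a (map e [0..<m])"
    using n1[of m] by (auto simp: m_def)
  obtain g where g: "recursive (Suc (Suc m)) g"
      "\<And>e. G (e 0) (e (Suc 0)) (\<lambda>i. e (Suc (Suc i))) = g (map e [0..<Suc (Suc m)])"
    using n2[of "Suc (Suc m)"] by (auto simp: m_def simp del: upt_Suc)
  have g': "G k r e = g (k # r # map e [0..<m])" for k r e
    using g(2)[of "case_nat k (case_nat r e)"] by (simp add: map_case_nat_upt del: upt_Suc)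
  let ?H = "\<lambda>xs. rec_nat (a (tl xs)) (\<lambda>k r. g (k # r # tl xs)) (hd xs)"
  have "recursive (Suc m) ?H"
    by (rule recursive.prim[OF a(1) g(1)])
  moreover have "rec_nat (A (\<lambda>i. e (Suc i))) (\<lambda>k r. G k r (\<lambda>i. e (Suc i))) (e 0) = ?H (map e [0..<Suc m])" for e
    by (simp add: a(2) g' upt_conv_Cons map_Suc_upt[symmetric] comp_def del: upt_Suc)
  ultimately have "computable (\<lambda>e. rec_nat (A (\<lambda>i. e (Suc i))) (\<lambda>k r. G k r (\<lambda>i. e (Suc i))) (e 0))"
    unfolding computable_def by blast
  \<comment> \<open>So far the recursion counter is variable \<open>0\<close>; the substitution puts
    \<open>N\<close> there and moves the remaining variables back.\<close>
  from computable_subst[OF this, of "\<lambda>i. case i of 0 \<Rightarrow> N | Suc j \<Rightarrow> (\<lambda>e. e j)"]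
  show ?thesis
    using N by (simp add: computable_var split: nat.split)
qed

lemma computable_mu:
  assumes F: "computable (\<lambda>e. F (e 0) (\<lambda>i. e (Suc i)))" and ex: "\<And>e. \<exists>k. F k e = 0"
  shows "computable (\<lambda>e. LEAST k. F k e = 0)"
proof -
  obtain n where n: "\<And>m. m \<ge> n \<Longrightarrow> \<exists>g. recursive m g \<and>
      (\<forall>e. F (e 0) (\<lambda>i. e (Suc i)) = g (map e [0..<m]))"
    using computable_arity[OF F] by blast
  obtain g where g: "recursive (Suc n) g"
      "\<And>e. F (e 0) (\<lambda>i. e (Suc i)) = g (map e [0..<Suc n])"
    using n[of "Suc n"] by (auto simp del: upt_Suc)
  have g': "F k e = g (k # map e [0..<n])" for k e
    using g(2)[of "case_nat k e"] by (simp add: map_case_nat_upt del: upt_Suc)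
  have "recursive n (\<lambda>xs. LEAST k. g (k # xs) = 0)"
  proof (rule recursive.mu[OF g(1)], intro allI impI)
    \<comment> \<open>Regularity concerns lists, the hypothesis \<open>ex\<close> environments:
      \<open>xs\<close> is read as the environment of its entries, of which \<open>g\<close> sees
      only the first \<open>n\<close>.\<close>
    fix xs :: "nat list"
    assume "length xs = n"
    then have "map (\<lambda>i. xs ! i) [0..<n] = xs"
      by (metis map_nth)
    then show "\<exists>k. g (k # xs) = 0"
      using ex[of "\<lambda>i. xs ! i"] by (simp add: g')
  qed
  then show ?thesis
    unfolding computable_def by (auto simp: g')
qed

text \<open>A decider has one argument, so the input is supplied to every variable; the predicate to
  which this is applied reads variable \<open>0\<close> only.\<close>

lemma computable_decides:
  assumes "computable F"
  shows "\<exists>d. recursive 1 d \<and> (\<forall>x. d [x] = F (\<lambda>_. x))"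
proof -
  obtain n g where g: "recursive n g" "\<And>e. F e = g (map e [0..<n])"
    using assms unfolding computable_def by blast
  let ?gs = "replicate n (\<lambda>xs :: nat list. xs ! 0)"
  have "recursive 1 (\<lambda>xs. g (map (\<lambda>h. h xs) ?gs))"
    using g(1) by (intro recursive.comp) (auto intro: recursive.proj)
  then show ?thesis
    by (intro exI conjI) (auto simp: g(2) map_replicate_const)
qed

section \<open>Arithmetic, Boolean operations and bounded quantifiers\<close>

definition computable_pred :: "((nat \<Rightarrow> nat) \<Rightarrow> bool) \<Rightarrow> bool" where
  "computable_pred P \<longleftrightarrow> computable (\<lambda>e. of_bool (P e))"

lemma computable_add [comp_intro]:
  "computable A \<Longrightarrow> computable B \<Longrightarrow> computable (\<lambda>e. A e + B e)"
proof (rule computable_2[of "(+)"])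
  have "computable (\<lambda>e. rec_nat (e 0) (\<lambda>k r. Suc r) (e 1))"
    by (intro comp_intro)
  moreover have "rec_nat a (\<lambda>k r. Suc r) b = a + b" for a b :: nat
    by (induction b) auto
  ultimately show "computable (\<lambda>e. e 0 + e 1)" by simp
qed

lemma computable_mult [comp_intro]:
  "computable A \<Longrightarrow> computable B \<Longrightarrow> computable (\<lambda>e. A e * B e)"
proof (rule computable_2[of "(*)"])
  have "computable (\<lambda>e. rec_nat 0 (\<lambda>k r. r + e 0) (e 1))"
    by (intro comp_intro)
  moreover have "rec_nat 0 (\<lambda>k r. r + a) b = a * b" for a b :: nat
    by (induction b) auto
  ultimately show "computable (\<lambda>e. e 0 * e 1)" by simp
qed

lemma computable_power [comp_intro]:
  "computable A \<Longrightarrow> computable B \<Longrightarrow> computable (\<lambda>e. A e ^ B e)"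
proof (rule computable_2[of "(^)"])
  have "computable (\<lambda>e. rec_nat 1 (\<lambda>k r. r * e 0) (e 1))"
    by (intro comp_intro)
  moreover have "rec_nat 1 (\<lambda>k r. r * a) b = a ^ b" for a b :: nat
    by (induction b) auto
  ultimately show "computable (\<lambda>e. e 0 ^ e 1)" by simp
qed

lemma computable_diff [comp_intro]:
  "computable A \<Longrightarrow> computable B \<Longrightarrow> computable (\<lambda>e. A e - B e)"
proof (rule computable_2[of "(-)"])
  \<comment> \<open>The inner recursion is the predecessor: its step returns the counter and
    discards the accumulated value.\<close>
  have "computable (\<lambda>e. rec_nat (e 0) (\<lambda>k r. rec_nat 0 (\<lambda>k' r'. k') r) (e 1))"
    by (intro comp_intro)
  moreover have "rec_nat 0 (\<lambda>k' r'. k') r = r - 1" for r :: nat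
    by (cases r) auto
  moreover have "rec_nat a (\<lambda>k r. r - 1) b = a - b" for a b :: nat
    by (induction b) auto
  ultimately show "computable (\<lambda>e. e 0 - e 1)" by simp
qed

lemma computable_pred_const [comp_intro]: "computable_pred (\<lambda>e. c)"
  unfolding computable_pred_def by (rule computable_const)

lemma computable_pred_not [comp_intro]:
  assumes "computable_pred P" shows "computable_pred (\<lambda>e. \<not> P e)"
proof -
  have "computable (\<lambda>e. 1 - of_bool (P e))"
    using assms unfolding computable_pred_def by (intro comp_intro)
  moreover have "1 - of_bool p = (of_bool (\<not> p) :: nat)" for p
    by simp
  ultimately show ?thesis
    unfolding computable_pred_def by (simp only:)
qed

lemma computable_pred_conj [comp_intro]:
  assumes "computable_pred P" "computable_pred Q" shows "computable_pred (\<lambda>e. P e \<and> Q e)"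
  using computable_mult[OF assms[unfolded computable_pred_def]]
  unfolding computable_pred_def by (simp only: of_bool_conj)

lemma computable_pred_disj [comp_intro]:
  assumes "computable_pred P" "computable_pred Q" shows "computable_pred (\<lambda>e. P e \<or> Q e)"
proof -
  have "computable_pred (\<lambda>e. \<not> (\<not> P e \<and> \<not> Q e))"
    using assms by (intro computable_pred_not computable_pred_conj)
  then show ?thesis by simp
qed

lemma computable_pred_imp [comp_intro]:
  assumes "computable_pred P" "computable_pred Q" shows "computable_pred (\<lambda>e. P e \<longrightarrow> Q e)"
  using computable_pred_disj[OF computable_pred_not[OF assms(1)] assms(2)] by simp

lemma computable_pred_iff [comp_intro]:
  assumes "computable_pred P" "computable_pred Q" shows "computable_pred (\<lambda>e. P e \<longleftrightarrow> Q e)"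
  unfolding iff_conv_conj_imp using assms by (intro comp_intro)

lemma computable_pred_le [comp_intro]:
  assumes "computable A" "computable B" shows "computable_pred (\<lambda>e. A e \<le> B e)"
proof -
  have "computable (\<lambda>e. 1 - (A e - B e))"
    using assms by (intro comp_intro)
  moreover have "1 - (a - b) = of_bool (a \<le> b)" for a b :: nat by auto
  ultimately show ?thesis
    unfolding computable_pred_def by simp
qed

lemma computable_pred_less [comp_intro]:
  "computable A \<Longrightarrow> computable B \<Longrightarrow> computable_pred (\<lambda>e. A e < B e)"
  unfolding Suc_le_eq[symmetric] by (intro comp_intro)

lemma computable_pred_eq [comp_intro]:
  "computable A \<Longrightarrow> computable B \<Longrightarrow> computable_pred (\<lambda>e. A e = B e)"
  for A B :: "(nat \<Rightarrow> nat) \<Rightarrow> nat"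
  unfolding order.eq_iff by (intro comp_intro)

lemma computable_if [comp_intro]:
  assumes "computable_pred P" "computable A" "computable B"
  shows "computable (\<lambda>e. if P e then A e else B e)"
proof -
  have "computable (\<lambda>e. of_bool (P e) * A e + (1 - of_bool (P e)) * B e)"
    using assms unfolding computable_pred_def by (intro comp_intro)
  moreover have "of_bool p * a + (1 - of_bool p) * b = (if p then a else b)" for p and a b :: nat
    by simp
  ultimately show ?thesis by (simp only:)
qed

lemma computable_Least [comp_intro]:
  assumes P: "computable_pred (\<lambda>e. P (e 0) (\<lambda>i. e (Suc i)))" and ex: "\<And>e. \<exists>k. P k e"
  shows "computable (\<lambda>e. LEAST k. P k e)"
proof -
  have "computable (\<lambda>e. LEAST k. of_bool (\<not> P k e) = (0 :: nat))"
    using computable_pred_not[OF P] ex unfolding computable_pred_def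
    by (intro computable_mu) auto
  then show ?thesis by simp
qed

text \<open>A search for the least counterexample. Stopping also at the bound makes the search
  total, as \<open>computable_Least\<close> requires, and the statement holds iff the search gets as
  far as the bound.\<close>

lemma computable_pred_ball [comp_intro]:
  assumes B: "computable B" and P: "computable_pred (\<lambda>e. P (e 0) (\<lambda>i. e (Suc i)))"
  shows "computable_pred (\<lambda>e. \<forall>k<B e. P k e)"
proof -
  have "computable_pred (\<lambda>e. B (\<lambda>i. e (Suc i)) \<le> e 0 \<or> \<not> P (e 0) (\<lambda>i. e (Suc i)))"
    by (intro comp_intro computable_shift[OF B] P)
  then have "computable (\<lambda>e. LEAST k. B e \<le> k \<or> \<not> P k e)"
    by (rule computable_Least) blast
  then have "computable_pred (\<lambda>e. B e \<le> (LEAST k. B e \<le> k \<or> \<not> P k e))"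
    by (rule computable_pred_le[OF B])
  moreover have "b \<le> (LEAST k. b \<le> k \<or> \<not> Q k) \<longleftrightarrow> (\<forall>k<b. Q k)" for b :: nat and Q
  proof
    assume "b \<le> (LEAST k. b \<le> k \<or> \<not> Q k)"
    then show "\<forall>k<b. Q k"
      using not_less_Least[of _ "\<lambda>k. b \<le> k \<or> \<not> Q k"] by (meson less_le_trans)
  next
    assume "\<forall>k<b. Q k"
    moreover have "b \<le> (LEAST k. b \<le> k \<or> \<not> Q k) \<or> \<not> Q (LEAST k. b \<le> k \<or> \<not> Q k)"
      by (rule LeastI[of "\<lambda>k. b \<le> k \<or> \<not> Q k" b]) blast
    ultimately show "b \<le> (LEAST k. b \<le> k \<or> \<not> Q k)"
      using not_le by blast
  qed
  ultimately show ?thesis by (simp only:)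
qed

lemma computable_pred_bex [comp_intro]:
  assumes B: "computable B" and P: "computable_pred (\<lambda>e. P (e 0) (\<lambda>i. e (Suc i)))"
  shows "computable_pred (\<lambda>e. \<exists>k<B e. P k e)"
proof -
  have "computable_pred (\<lambda>e. \<not> (\<forall>k<B e. \<not> P k e))"
    by (intro computable_pred_not computable_pred_ball B P)
  then show ?thesis by simp
qed

lemma computable_div [comp_intro]:
  "computable A \<Longrightarrow> computable B \<Longrightarrow> computable (\<lambda>e. A e div B e)"
proof (rule computable_2[of "(div)"])
  \<comment> \<open>The disjunct \<open>y = 0\<close> makes the search total and lets it stop at
    \<open>0\<close>, which is the value of \<open>x div 0\<close>.\<close>
  have *: "\<exists>q. y = 0 \<or> x < Suc q * y" for x y :: nat
    by (intro exI[of _ x]) (cases y; simp)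
  have "computable (\<lambda>e. LEAST q. e 1 = 0 \<or> e 0 < Suc q * e 1)"
    by (intro comp_intro *)
  moreover have "(LEAST q. y = 0 \<or> x < Suc q * y) = x div y" for x y :: nat
  proof (rule Least_equality)
    show "y = 0 \<or> x < Suc (x div y) * y"
      by (metis dividend_less_div_times mult_Suc add.commute neq0_conv)
    show "x div y \<le> q" if "y = 0 \<or> x < Suc q * y" for q
      using that by (metis div_by_0 less_Suc_eq_le less_mult_imp_div_less zero_le)
  qed
  ultimately show "computable (\<lambda>e. e 0 div e 1)" by simp
qed

lemma computable_mod [comp_intro]:
  "computable A \<Longrightarrow> computable B \<Longrightarrow> computable (\<lambda>e. A e mod B e)"
  unfolding minus_div_mult_eq_mod[symmetric] by (intro comp_intro)

section \<open>Decoding of pairs, sets and lists\<close>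

lemma computable_prod_encode [comp_intro]:
  "computable A \<Longrightarrow> computable B \<Longrightarrow> computable (\<lambda>e. prod_encode (A e, B e))"
  unfolding prod_encode_def triangle_def by (simp, intro comp_intro)

text \<open>Both components are at most the code, so unpairing becomes a least-number search over
  one component with a bounded quantifier over the other.\<close>

lemma ex_prod_encode: "\<exists>a. \<exists>b<Suc n. prod_encode (a, b) = n" "\<exists>b. \<exists>a<Suc n. prod_encode (a, b) = n"
  using le_prod_encode_1 le_prod_encode_2 prod_decode_inverse by (metis le_imp_less_Suc surj_pair)+

lemma computable_fst_prod_decode [comp_intro]:
  "computable A \<Longrightarrow> computable (\<lambda>e. fst (prod_decode (A e)))"
proof (rule computable_1[of "\<lambda>n. fst (prod_decode n)"])
  have "computable (\<lambda>e. LEAST a. \<exists>b<Suc (e 0). prod_encode (a, b) = e 0)"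
    by (intro comp_intro ex_prod_encode)
  moreover have "(LEAST a. \<exists>b<Suc n. prod_encode (a, b) = n) = fst (prod_decode n)" for n
    by (intro Least_equality) (auto simp: le_prod_encode_2 less_Suc_eq_le,
      metis le_prod_encode_2 prod.collapse prod_decode_inverse)
  ultimately show "computable (\<lambda>e. fst (prod_decode (e 0)))" by simp
qed

lemma computable_snd_prod_decode [comp_intro]:
  "computable A \<Longrightarrow> computable (\<lambda>e. snd (prod_decode (A e)))"
proof (rule computable_1[of "\<lambda>n. snd (prod_decode n)"])
  have "computable (\<lambda>e. LEAST b. \<exists>a<Suc (e 0). prod_encode (a, b) = e 0)"
    by (intro comp_intro ex_prod_encode)
  moreover have "(LEAST b. \<exists>a<Suc n. prod_encode (a, b) = n) = snd (prod_decode n)" for n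
    by (intro Least_equality) (auto simp: le_prod_encode_1 less_Suc_eq_le,
      metis le_prod_encode_1 prod.collapse prod_decode_inverse)
  ultimately show "computable (\<lambda>e. snd (prod_decode (e 0)))" by simp
qed

lemma computable_pred_set_decode [comp_intro]:
  "computable A \<Longrightarrow> computable B \<Longrightarrow> computable_pred (\<lambda>e. A e \<in> set_decode (B e))"
  unfolding set_decode_def mem_Collect_eq odd_iff_mod_2_eq_one by (intro comp_intro)

text \<open>A nonempty list has the code \<open>Suc (prod_encode (x, c))\<close> with
  \<open>c\<close> the code of its tail; hence the \<open>r - 1\<close>. The code \<open>0\<close>
  of the empty list is kept, because \<open>prod_decode 0 = (0, 0)\<close>.\<close>

definition code_drop :: "nat \<Rightarrow> nat \<Rightarrow> nat" where
  "code_drop c k = rec_nat c (\<lambda>_ r. snd (prod_decode (r - 1))) k"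

definition code_nth :: "nat \<Rightarrow> nat \<Rightarrow> nat" where
  "code_nth c k = fst (prod_decode (code_drop c k - 1))"

definition code_length :: "nat \<Rightarrow> nat" where
  "code_length c = (LEAST k. code_drop c k = 0)"

lemma code_drop_list_encode: "code_drop (list_encode xs) k = list_encode (drop k xs)"
proof (induction k)
  case (Suc k)
  have "prod_encode (0, 0) = 0"
    by (simp add: prod_encode_def)
  then have "prod_decode 0 = (0, 0)"
    by (metis prod_encode_inverse)
  then have "snd (prod_decode (list_encode ys - 1)) = list_encode (tl ys)" for ys
    by (cases ys) auto
  with Suc show ?case
    by (simp add: code_drop_def drop_Suc tl_drop)
qed (simp add: code_drop_def)

lemma code_nth_list_encode [simp]: "k < length xs \<Longrightarrow> code_nth (list_encode xs) k = xs ! k"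
  by (simp add: code_nth_def code_drop_list_encode Cons_nth_drop_Suc[symmetric])

lemma list_encode_eq_0_iff: "list_encode xs = 0 \<longleftrightarrow> xs = []"
  by (cases xs) auto

lemma code_length_list_encode [simp]: "code_length (list_encode xs) = length xs"
  unfolding code_length_def code_drop_list_encode list_encode_eq_0_iff
  by (auto intro!: Least_equality)

lemma computable_code_drop [comp_intro]:
  "computable A \<Longrightarrow> computable B \<Longrightarrow> computable (\<lambda>e. code_drop (A e) (B e))"
  by (rule computable_2[of code_drop], unfold code_drop_def, intro comp_intro)

lemma computable_code_nth [comp_intro]:
  "computable A \<Longrightarrow> computable B \<Longrightarrow> computable (\<lambda>e. code_nth (A e) (B e))"
  unfolding code_nth_def by (intro comp_intro)

lemma computable_code_length [comp_intro]:
  "computable A \<Longrightarrow> computable (\<lambda>e. code_length (A e))"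
proof (rule computable_1[of code_length], unfold code_length_def, intro comp_intro)
  show "\<exists>k. code_drop (e 0) k = 0" for e :: "nat \<Rightarrow> nat"
    using code_drop_list_encode[of "list_decode (e 0)" "length (list_decode (e 0))"] by auto
qed

section \<open>Extension of injections and digit expansions\<close>

lemma extend_injection:
  assumes "finite B" "A \<subseteq> B" "inj_on u A" "u ` A \<subseteq> M" "finite M \<Longrightarrow> card B \<le> card M"
  shows "\<exists>u'. inj_on u' B \<and> u' ` B \<subseteq> M \<and> (\<forall>x\<in>A. u' x = u x)"
proof -
  have fin: "finite A" "finite (B - A)" "finite (u ` A)"
    using assms(1,2) by (auto intro: finite_subset)
  obtain N where N: "N \<subseteq> M - u ` A" "finite N" "card N = card (B - A)"
  proof (cases "finite M")
    case True
    have "card (u ` A) = card A"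
      using assms(3) by (rule card_image)
    then have "card (B - A) \<le> card (M - u ` A)"
      using assms fin True by (simp add: card_Diff_subset)
    then show ?thesis
      using that True by (meson obtain_subset_with_card_n)
  next
    case False
    then have "infinite (M - u ` A)"
      using fin(3) by simp
    then show ?thesis
      using that infinite_arbitrarily_large by metis
  qed
  then obtain h where h: "bij_betw h (B - A) N"
    using fin(2) finite_same_card_bij by metis
  let ?u = "\<lambda>x. if x \<in> A then u x else h x"
  have hM: "h ` (B - A) \<subseteq> M - u ` A" and "inj_on h (B - A)"
    using h N(1) by (auto simp: bij_betw_def)
  then have "inj_on ?u (A \<union> (B - A))"
    using assms(3) by (intro inj_on_disjoint_Un) auto
  then have "inj_on ?u B"
    using assms(2) by (simp add: Un_absorb1)
  moreover have "?u ` B \<subseteq> M"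
    using hM assms(4) by auto
  ultimately show ?thesis
    by (intro exI[of _ ?u]) auto
qed

text \<open>Horner's scheme, lowest digit first. It turns a quantifier over finitely many labels of
  bounded size into a bounded quantifier over numbers.\<close>

lemma ex_digits:
  fixes K :: nat
  assumes "\<And>i. d i < K"
  shows "\<exists>w<K ^ N. \<forall>i<N. w div K ^ i mod K = d i"
  using assms
proof (induction N arbitrary: d)
  case (Suc N)
  obtain w where w: "w < K ^ N" "\<And>i. i < N \<Longrightarrow> w div K ^ i mod K = d (Suc i)"
    using Suc.IH[of "\<lambda>i. d (Suc i)"] Suc.prems by auto
  have d0: "d 0 < K"
    by (rule Suc.prems)
  have "d 0 + K * w < K * Suc w"
    using d0 by simp
  also have "\<dots> \<le> K * K ^ N"
    using w(1) by (intro mult_le_mono2) simp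
  finally have "d 0 + K * w < K ^ Suc N"
    by simp
  moreover have "(d 0 + K * w) div K ^ i mod K = d i" if "i < Suc N" for i
  proof (cases i)
    case (Suc j)
    then show ?thesis
      using w(2)[of j] that d0 by (simp add: div_mult2_eq)
  qed (use d0 in simp)
  ultimately show ?case
    by (intro exI[of _ "d 0 + K * w"]) simp
qed simp

section \<open>Overlapping up to injective relabelling\<close>

definition constants :: "'d rdf_domain \<Rightarrow> 'd set" where
  "constants D = Lit D - NullLit D"

text \<open>In what follows, \<open>\<phi> 0\<close> and \<open>\<phi> 1\<close> are the bodies of two dependencies, and \<open>v 0\<close> and \<open>v 1\<close>
  valuations of their variables.\<close>

definition wf_bodies :: "rel_schema \<Rightarrow> (nat \<Rightarrow> (nat \<times> nat list) list) \<Rightarrow> bool" where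
  "wf_bodies S \<phi> \<longleftrightarrow>
     (\<forall>s<2. \<forall>R xs. (R, xs) \<in> set (\<phi> s) \<longrightarrow> R \<in> rsyms S \<and> length xs = rarity S R)"

definition body_values :: "(nat \<Rightarrow> (nat \<times> nat list) list) \<Rightarrow> (nat \<Rightarrow> nat \<Rightarrow> 'a) \<Rightarrow> 'a set" where
  "body_values \<phi> v = (\<Union>s<2. v s ` body_vars (\<phi> s))"

text \<open>The dependencies for the tuples that the two bodies produce, stated without an instance
  and for values of any type, so that it applies to labels as well as to domain elements.\<close>

definition fd_consistent ::
  "rel_schema \<Rightarrow> (nat \<Rightarrow> (nat \<times> nat list) list) \<Rightarrow> (nat \<Rightarrow> nat \<Rightarrow> 'a) \<Rightarrow> bool" where
  "fd_consistent S \<phi> v \<longleftrightarrow>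
     (\<forall>s<2. \<forall>s'<2. \<forall>R xs ys X Y. (R, xs) \<in> set (\<phi> s) \<longrightarrow> (R, ys) \<in> set (\<phi> s') \<longrightarrow>
        (R, X, Y) \<in> fds S \<longrightarrow> (\<forall>i\<in>X. v s (xs ! i) = v s' (ys ! i)) \<longrightarrow>
        (\<forall>j\<in>Y. v s (xs ! j) = v s' (ys ! j)))"

lemma finite_body_vars: "finite (body_vars \<phi>)"
  by (auto simp: body_vars_def)

lemma body_varsI: "(R, xs) \<in> set \<phi> \<Longrightarrow> y \<in> set xs \<Longrightarrow> y \<in> body_vars \<phi>"
  by (force simp: body_vars_def)

lemma body_valuesI: "s < 2 \<Longrightarrow> y \<in> body_vars (\<phi> s) \<Longrightarrow> v s y \<in> body_values \<phi> v"
  by (auto simp: body_values_def)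

lemma finite_body_values: "finite (body_values \<phi> v)"
  by (simp add: body_values_def finite_body_vars)

lemma fd_positions:
  assumes "wf_rel_schema S" "(R, X, Y) \<in> fds S" "i \<in> X \<or> i \<in> Y"
  shows "i < rarity S R"
  using assms by (fastforce simp: wf_rel_schema_def)

text \<open>Dependencies compare values for equality only, and an injection preserves and reflects
  equality. As \<open>v'\<close> is prescribed only on body variables, the case of the identity says
  that other variables have no influence.\<close>

lemma fd_consistent_relabel:
  assumes S: "wf_rel_schema S" and \<phi>: "wf_bodies S \<phi>"
    and u: "inj_on u (body_values \<phi> v)"
    and v': "\<And>s y. s < 2 \<Longrightarrow> y \<in> body_vars (\<phi> s) \<Longrightarrow> v' s y = u (v s y)"
  shows "fd_consistent S \<phi> v' \<longleftrightarrow> fd_consistent S \<phi> v"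
proof -
  have eq: "v' s (xs ! i) = v' s' (ys ! i) \<longleftrightarrow> v s (xs ! i) = v s' (ys ! i)"
    if "s < 2" "s' < 2" "(R, xs) \<in> set (\<phi> s)" "(R, ys) \<in> set (\<phi> s')" "(R, X, Y) \<in> fds S"
      "i \<in> X \<or> i \<in> Y" for s s' R xs ys X Y i
  proof -
    have "i < length xs" "i < length ys"
      using that \<phi> fd_positions[OF S that(5,6)] by (auto simp: wf_bodies_def)
    then have "xs ! i \<in> body_vars (\<phi> s)" "ys ! i \<in> body_vars (\<phi> s')"
      using that body_varsI by (metis nth_mem)+
    then show ?thesis
      using that v' u body_valuesI by (metis inj_onD)
  qed
  show ?thesis
    unfolding fd_consistent_def using eq by (intro iffI allI impI ballI; meson)
qed

lemma valid_instance_imp_fd_consistent: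
  assumes \<phi>: "wf_bodies S \<phi>" and S: "wf_rel_schema S" and I: "valid_instance D S I"
    and sat: "\<And>s. s < 2 \<Longrightarrow> sat_body I (v s) (\<phi> s)"
  shows "body_values \<phi> v \<subseteq> constants D" "fd_consistent S \<phi> v"
proof -
  have tup: "map (v s) xs \<in> I R" "R \<in> rsyms S" "length xs = rarity S R"
    if "s < 2" "(R, xs) \<in> set (\<phi> s)" for s R xs
    using that sat \<phi> by (fastforce simp: sat_body_def wf_bodies_def)+
  show "body_values \<phi> v \<subseteq> constants D"
  proof
    fix d
    assume "d \<in> body_values \<phi> v"
    then obtain s R xs y where "s < 2" "(R, xs) \<in> set (\<phi> s)" "y \<in> set xs" "d = v s y"
      by (auto simp: body_values_def body_vars_def)
    with tup[of s R xs] I show "d \<in> constants D"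
      by (fastforce simp: valid_instance_def is_instance_def constants_def)
  qed
  show "fd_consistent S \<phi> v"
    unfolding fd_consistent_def
  proof (intro allI impI)
    fix s s' R xs ys X Y
    assume *: "s < 2" "s' < 2" "(R, xs) \<in> set (\<phi> s)" "(R, ys) \<in> set (\<phi> s')" "(R, X, Y) \<in> fds S"
      and X: "\<forall>i\<in>X. v s (xs ! i) = v s' (ys ! i)"
    have "satisfies_fd I (R, X, Y)"
      using I *(5) by (auto simp: valid_instance_def)
    moreover have "i < length xs" "i < length ys" if "i \<in> X \<or> i \<in> Y" for i
      using fd_positions[OF S *(5) that] tup * by auto
    ultimately show "\<forall>j\<in>Y. v s (xs ! j) = v s' (ys ! j)"
      using tup(1)[OF *(1,3)] tup(1)[OF *(2,4)] X by (fastforce simp: satisfies_fd_def)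
  qed
qed

text \<open>The image of the bodies is a witness: a functional dependency never demands additional
  tuples.\<close>

lemma fd_consistent_imp_valid_instance:
  assumes \<phi>: "wf_bodies S \<phi>" and S: "wf_rel_schema S"
    and v: "body_values \<phi> v \<subseteq> constants D" "fd_consistent S \<phi> v"
  shows "\<exists>I. valid_instance D S I \<and> (\<forall>s<2. sat_body I (v s) (\<phi> s))"
proof (intro exI conjI)
  let ?I = "\<lambda>R. {map (v s) xs |s xs. s < 2 \<and> (R, xs) \<in> set (\<phi> s)}"
  have "length t = rarity S R \<and> set t \<subseteq> Lit D - NullLit D" if t: "t \<in> ?I R" for R t
  proof -
    obtain s xs where *: "t = map (v s) xs" "s < 2" "(R, xs) \<in> set (\<phi> s)"
      using t by blast
    have "v s y \<in> constants D" if "y \<in> set xs" for y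
      using v(1) body_valuesI[of s y \<phi> v, OF *(2) body_varsI[OF *(3) that]] by blast
    then show ?thesis
      using * \<phi> by (auto simp: wf_bodies_def constants_def)
  qed
  then have "is_instance D S ?I"
    unfolding is_instance_def by blast
  moreover have "satisfies_fd ?I (R, X, Y)" if fd: "(R, X, Y) \<in> fds S" for R X Y
    unfolding satisfies_fd_def prod.case
  proof (intro ballI impI)
    fix t u j
    assume tu: "t \<in> ?I R" "u \<in> ?I R" and X: "\<forall>i\<in>X. t ! i = u ! i" and j: "j \<in> Y"
    obtain s xs where t: "t = map (v s) xs" "s < 2" "(R, xs) \<in> set (\<phi> s)"
      using tu by blast
    obtain s' ys where u: "u = map (v s') ys" "s' < 2" "(R, ys) \<in> set (\<phi> s')"
      using tu by blast
    have len: "i < length xs" "i < length ys" if "i \<in> X \<or> i \<in> Y" for i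
      using fd_positions[OF S fd that] \<phi> t u by (auto simp: wf_bodies_def)
    have "\<forall>i\<in>X. v s (xs ! i) = v s' (ys ! i)"
      using X len t u by auto
    then have "v s (xs ! j) = v s' (ys ! j)"
      using v(2) t u fd j unfolding fd_consistent_def by meson
    then show "t ! j = u ! j"
      using t u len j by simp
  qed
  ultimately show "valid_instance D S ?I"
    by (auto simp: valid_instance_def)
  show "\<forall>s<2. sat_body ?I (v s) (\<phi> s)"
    by (auto simp: sat_body_def)
qed

section \<open>Reduction to finitely many labels\<close>

lemma eval_trm_cong:
  "(\<And>y. y \<in> trm_vars t \<Longrightarrow> v y = v' y) \<Longrightarrow> eval_trm J v t = eval_trm J v' t"
  by (cases t) (auto cong: map_cong)

text \<open>Small-model property. A labelling followed by an interpretation \<open>u\<close> is a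
  pair of valuations by constants; conversely, the values taken in an instance are numbered
  consecutively, and \<open>u\<close> undoes the numbering. Consecutive numbers also stay below the
  number of constants, so the search can be confined to labellings that some \<open>u\<close>
  realizes.\<close>

lemma overlap_iff_relabelled:
  fixes ob :: "nat \<Rightarrow> 'd trm"
  assumes S: "wf_rel_schema S" and \<phi>: "wf_bodies S \<phi>"
    and K: "K > 0" "card (body_vars (\<phi> 0)) + card (body_vars (\<phi> 1)) \<le> K"
    and xs: "\<And>s. s < 2 \<Longrightarrow> set (xs s) \<subseteq> body_vars (\<phi> s)"
    and ob: "\<And>s. s < 2 \<Longrightarrow> trm_vars (ob s) \<subseteq> body_vars (\<phi> s)"
  shows "(\<forall>I v. valid_instance D S I \<longrightarrow> (\<forall>s<2. sat_body I (v s) (\<phi> s)) \<longrightarrow>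
           map (v 0) (xs 0) = map (v 1) (xs 1) \<longrightarrow> eval_trm J (v 0) (ob 0) = eval_trm J (v 1) (ob 1))
     \<longleftrightarrow> (\<forall>v. (\<forall>s y. v s y < K) \<longrightarrow>
           (finite (constants D) \<longrightarrow> body_values \<phi> v \<subseteq> {..<card (constants D)}) \<longrightarrow>
           fd_consistent S \<phi> v \<longrightarrow> map (v 0) (xs 0) = map (v 1) (xs 1) \<longrightarrow>
           (\<forall>u. inj_on u (body_values \<phi> v) \<longrightarrow> u ` body_values \<phi> v \<subseteq> constants D \<longrightarrow>
              eval_trm J (\<lambda>y. u (v 0 y)) (ob 0) = eval_trm J (\<lambda>y. u (v 1 y)) (ob 1)))"
    (is "?L \<longleftrightarrow> ?R")
proof
  assume L: ?L
  show ?R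
  proof (intro allI impI)
    fix v :: "nat \<Rightarrow> nat \<Rightarrow> nat" and u
    assume v: "fd_consistent S \<phi> v" "map (v 0) (xs 0) = map (v 1) (xs 1)"
      and u: "inj_on u (body_values \<phi> v)" "u ` body_values \<phi> v \<subseteq> constants D"
    let ?v = "\<lambda>s y. u (v s y)"
    have "fd_consistent S \<phi> ?v"
      using fd_consistent_relabel[OF S \<phi> u(1)] v(1) by simp
    moreover have "body_values \<phi> ?v \<subseteq> constants D"
      using u(2) by (auto simp: body_values_def)
    ultimately obtain I where I: "valid_instance D S I" "\<forall>s<2. sat_body I (?v s) (\<phi> s)"
      using fd_consistent_imp_valid_instance[OF \<phi> S, of ?v D] by blast
    have "map (?v 0) (xs 0) = map (?v 1) (xs 1)"
      using arg_cong[OF v(2), of "map u"] by (simp add: comp_def)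
    then show "eval_trm J (?v 0) (ob 0) = eval_trm J (?v 1) (ob 1)"
      using L[rule_format, of I ?v] I by blast
  qed
next
  assume R: ?R
  show ?L
  proof (intro allI impI)
    fix I and v :: "nat \<Rightarrow> nat \<Rightarrow> 'd"
    assume I: "valid_instance D S I" and sat: "\<forall>s<2. sat_body I (v s) (\<phi> s)"
      and eq: "map (v 0) (xs 0) = map (v 1) (xs 1)"
    let ?B = "body_values \<phi> v"
    have con: "?B \<subseteq> constants D" "fd_consistent S \<phi> v"
      using valid_instance_imp_fd_consistent[OF \<phi> S I] sat by blast+
    have B: "?B = v 0 ` body_vars (\<phi> 0) \<union> v 1 ` body_vars (\<phi> 1)"
      by (auto simp: body_values_def less_2_cases_iff)
    have "card ?B \<le> card (v 0 ` body_vars (\<phi> 0)) + card (v 1 ` body_vars (\<phi> 1))"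
      unfolding B by (rule card_Un_le)
    also have "\<dots> \<le> K"
      using K(2) card_image_le[OF finite_body_vars] by (meson add_mono order_trans)
    finally have cardB: "card ?B \<le> K" .
    obtain h where h: "bij_betw h ?B {..<card ?B}"
      using ex_bij_betw_finite_nat[OF finite_body_values] atLeast0LessThan by metis
    \<comment> \<open>Values outside the bodies become \<open>0\<close>; this keeps every label
      below \<open>K\<close>, which is why \<open>K > 0\<close> is assumed.\<close>
    define w where "w = (\<lambda>s y. if v s y \<in> ?B then h (v s y) else 0)"
    have w: "w s y = h (v s y)" if "s < 2" "y \<in> body_vars (\<phi> s)" for s y
      using body_valuesI[of s y \<phi> v, OF that] by (simp add: w_def)
    have Bw: "body_values \<phi> w = h ` ?B"
      using w by (force simp: body_values_def)
    have hB: "h ` ?B = {..<card ?B}" "inj_on h ?B"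
      using h by (auto simp: bij_betw_def)
    have "w s y < K" for s y
      using hB(1) cardB K(1) unfolding w_def by (auto intro: less_le_trans)
    moreover have "body_values \<phi> w \<subseteq> {..<card (constants D)}" if "finite (constants D)"
      using card_mono[OF that con(1)] by (auto simp: Bw hB)
    moreover have "fd_consistent S \<phi> w"
      using fd_consistent_relabel[OF S \<phi> hB(2) w] con(2) by simp
    moreover have "map (w 0) (xs 0) = map (w 1) (xs 1)"
    proof -
      have m: "map (w s) (xs s) = map h (map (v s) (xs s))" if "s < 2" for s
        using w that xs[OF that] by auto
      have "map (w 0) (xs 0) = map h (map (v 0) (xs 0))"
        by (rule m) simp
      also have "\<dots> = map h (map (v 1) (xs 1))"
        by (simp only: eq)
      also have "\<dots> = map (w 1) (xs 1)"
        by (rule m[symmetric]) simp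
      finally show ?thesis .
    qed
    moreover have "inj_on (inv_into ?B h) (body_values \<phi> w)"
      unfolding Bw by (rule inj_on_inv_into) simp
    moreover have "inv_into ?B h ` body_values \<phi> w \<subseteq> constants D"
      using con(1) hB(2) by (auto simp: Bw)
    ultimately have "eval_trm J (\<lambda>y. inv_into ?B h (w 0 y)) (ob 0) = eval_trm J (\<lambda>y. inv_into ?B h (w 1 y)) (ob 1)"
      using R by blast
    moreover have "eval_trm J (\<lambda>y. inv_into ?B h (w s y)) (ob s) = eval_trm J (v s) (ob s)" if "s < 2" for s
    proof (rule eval_trm_cong)
      fix y
      assume "y \<in> trm_vars (ob s)"
      then have "y \<in> body_vars (\<phi> s)"
        using ob[OF that] by blast
      then show "inv_into ?B h (w s y) = v s y"
        using w that hB(2) body_valuesI by (metis inv_into_f_f)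
    qed
    ultimately show "eval_trm J (v 0) (ob 0) = eval_trm J (v 1) (ob 1)"
      by simp
  qed
qed

text \<open>The tuples \<open>a\<close> and \<open>b\<close> consist of labels, of which \<open>u\<close> ranges over all interpretations by
  pairwise distinct constants. The set of constants \<open>Lit - NullLit\<close> may be finite or empty, so there
  is such a \<open>u\<close> only if the labels are few enough.\<close>

definition decides_equality ::
  "'d rdf_domain \<Rightarrow> 'd iri_constructors \<Rightarrow> (nat \<Rightarrow> nat list \<Rightarrow> nat list \<Rightarrow> bool) \<Rightarrow> bool" where
  "decides_equality D C G \<longleftrightarrow>
     (\<forall>f\<in>fsyms C. \<forall>a b. length a = farity C f \<longrightarrow> length b = farity C f \<longrightarrow>
        (finite (constants D) \<longrightarrow> card (set a \<union> set b) \<le> card (constants D)) \<longrightarrow>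
        (G f a b \<longleftrightarrow>
           (\<forall>u. inj_on u (set a \<union> set b) \<longrightarrow> u ` (set a \<union> set b) \<subseteq> constants D \<longrightarrow>
              Fint C f (map u a) = Fint C f (map u b))))"

fun objects_agree ::
  "(nat \<Rightarrow> nat list \<Rightarrow> nat list \<Rightarrow> bool) \<Rightarrow> (nat \<Rightarrow> nat \<Rightarrow> nat) \<Rightarrow> 'd trm \<Rightarrow> 'd trm \<Rightarrow> bool" where
  "objects_agree G v (Var y) (Var z) \<longleftrightarrow> v 0 y = v 1 z"
| "objects_agree G v (App f ys) (App g zs) \<longleftrightarrow> f = g \<and> G f (map (v 0) ys) (map (v 1) zs)"
| "objects_agree G v _ _ \<longleftrightarrow> False"

lemma ex_injection:
  assumes "finite B" "finite M \<Longrightarrow> card B \<le> card M"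
  shows "\<exists>u. inj_on u B \<and> u ` B \<subseteq> M"
  using extend_injection[OF assms(1), of "{}" _ M] assms(2) by auto

text \<open>Some \<open>u\<close> exists by the bound on \<open>B\<close>: it separates distinct
  labels of variables and gives distinct constructors distinct values. For a single constructor only
  the labels of its arguments count, since every interpretation of these extends to
  \<open>B\<close>.\<close>

lemma objects_agree_iff:
  assumes C: "wf_iri_constructors D C" and G: "decides_equality D C G"
    and wf: "wf_trm C o1" "wf_trm C o2"
    and kind: "(\<exists>y z. o1 = Var y \<and> o2 = Var z) \<or> (\<exists>f ys g zs. o1 = App f ys \<and> o2 = App g zs)"
    and B: "finite B" "finite (constants D) \<Longrightarrow> card B \<le> card (constants D)"
    and vars: "v 0 ` trm_vars o1 \<subseteq> B" "v 1 ` trm_vars o2 \<subseteq> B"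
  shows "(\<forall>u. inj_on u B \<longrightarrow> u ` B \<subseteq> constants D \<longrightarrow>
            eval_trm (Fint C) (\<lambda>y. u (v 0 y)) o1 = eval_trm (Fint C) (\<lambda>y. u (v 1 y)) o2)
         \<longleftrightarrow> objects_agree G v o1 o2"
    (is "?L \<longleftrightarrow> _")
  using kind
proof (elim disjE exE conjE)
  fix y z
  assume o: "o1 = Var y" "o2 = Var z"
  obtain u where "inj_on u B" "u ` B \<subseteq> constants D"
    using ex_injection[OF B] by blast
  then show ?thesis
    using o vars by (auto dest: inj_onD)
next
  fix f ys g zs
  assume o: "o1 = App f ys" "o2 = App g zs"
  let ?a = "map (v 0) ys" and ?b = "map (v 1) zs"
  have sub: "set ?a \<union> set ?b \<subseteq> B"
    using o vars by auto
  have fg: "f \<in> fsyms C" "g \<in> fsyms C" "length ys = farity C f" "length zs = farity C g"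
    using o wf by (auto simp: wf_trm_def)
  show ?thesis
  proof (cases "f = g")
    case False
    obtain u where u: "inj_on u B" "u ` B \<subseteq> constants D"
      using ex_injection[OF B] by blast
    have "Fint C f (map u ?a) \<noteq> Fint C g (map u ?b)"
    proof
      assume "Fint C f (map u ?a) = Fint C g (map u ?b)"
      moreover have "Fint C f (map u ?a) \<in> Fint C f ` {t. length t = farity C f}"
        "Fint C g (map u ?b) \<in> Fint C g ` {t. length t = farity C g}"
        using fg by simp_all
      ultimately show False
        using C False fg(1,2) unfolding wf_iri_constructors_def by (metis IntI empty_iff)
    qed
    then show ?thesis
      using u o False by (auto simp: comp_def)
  next
    case True
    have "card (set ?a \<union> set ?b) \<le> card (constants D)" if "finite (constants D)"
      using card_mono[OF B(1) sub] B(2)[OF that] by simp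
    then have "G f ?a ?b \<longleftrightarrow>
           (\<forall>u. inj_on u (set ?a \<union> set ?b) \<longrightarrow> u ` (set ?a \<union> set ?b) \<subseteq> constants D \<longrightarrow>
              Fint C f (map u ?a) = Fint C f (map u ?b))"
      using G fg True unfolding decides_equality_def by (metis length_map)
    also have "\<dots> \<longleftrightarrow> (\<forall>u. inj_on u B \<longrightarrow> u ` B \<subseteq> constants D \<longrightarrow>
              Fint C f (map u ?a) = Fint C f (map u ?b))"
    proof (intro iffI allI impI)
      fix u
      assume all: "\<forall>u. inj_on u B \<longrightarrow> u ` B \<subseteq> constants D \<longrightarrow>
              Fint C f (map u ?a) = Fint C f (map u ?b)"
        and u: "inj_on u (set ?a \<union> set ?b)" "u ` (set ?a \<union> set ?b) \<subseteq> constants D"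
      obtain u' where u': "inj_on u' B" "u' ` B \<subseteq> constants D" "\<forall>x\<in>set ?a \<union> set ?b. u' x = u x"
        using extend_injection[OF B(1) sub u B(2)] by blast
      have "map u' ?a = map u ?a" "map u' ?b = map u ?b"
        using u'(3) by auto
      then show "Fint C f (map u ?a) = Fint C f (map u ?b)"
        using all u' by metis
    next
      fix u
      assume all: "\<forall>u. inj_on u (set ?a \<union> set ?b) \<longrightarrow> u ` (set ?a \<union> set ?b) \<subseteq> constants D \<longrightarrow>
              Fint C f (map u ?a) = Fint C f (map u ?b)"
        and u: "inj_on u B" "u ` B \<subseteq> constants D"
      show "Fint C f (map u ?a) = Fint C f (map u ?b)"
        using all inj_on_subset[OF u(1) sub] u(2) sub by blast
    qed
    finally show ?thesis
      using o True by (simp add: comp_def)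
  qed
qed

section \<open>Quantifiers over coded lists and sets\<close>

definition code_list_all :: "nat \<Rightarrow> (nat \<Rightarrow> bool) \<Rightarrow> bool" where
  "code_list_all c P \<longleftrightarrow> (\<forall>i<code_length c. P (code_nth c i))"

definition code_set_all :: "nat \<Rightarrow> (nat \<Rightarrow> bool) \<Rightarrow> bool" where
  "code_set_all c P \<longleftrightarrow> (\<forall>k<c. k \<in> set_decode c \<longrightarrow> P k)"

lemma code_list_all_list_encode [simp]: "code_list_all (list_encode xs) P \<longleftrightarrow> (\<forall>z\<in>set xs. P z)"
  by (simp add: code_list_all_def all_set_conv_all_nth)

text \<open>Bit \<open>k\<close> can be set only if \<open>2 ^ k \<le> c\<close>, and
  \<open>k < 2 ^ k\<close>. This bounds the quantifier over a coded set by the code itself.\<close>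

lemma mem_set_decode_less: "k \<in> set_decode c \<Longrightarrow> k < c"
proof -
  assume "k \<in> set_decode c"
  then have "odd (c div 2 ^ k)"
    by (simp add: set_decode_def)
  then have "c div 2 ^ k \<noteq> 0"
    by (intro notI) simp
  then have "2 ^ k \<le> c"
    by (simp add: div_eq_0_iff)
  then show ?thesis
    using less_exp[of k] by linarith
qed

lemma code_set_all_set_encode [simp]:
  "finite A \<Longrightarrow> code_set_all (set_encode A) P \<longleftrightarrow> (\<forall>k\<in>A. P k)"
  using mem_set_decode_less[of _ "set_encode A"] by (auto simp: code_set_all_def)

lemma computable_pred_code_list_all [comp_intro]:
  assumes c: "computable c" and P: "computable_pred (\<lambda>e. P (e 0) (\<lambda>i. e (Suc i)))"
  shows "computable_pred (\<lambda>e. code_list_all (c e) (\<lambda>z. P z e))"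
  unfolding code_list_all_def
proof (intro computable_pred_ball computable_code_length c)
  \<comment> \<open>The bound variable is an index into the list; it is replaced by the entry found
    there, and all other variables are kept.\<close>
  let ?G = "\<lambda>i e. case i of 0 \<Rightarrow> code_nth (c (\<lambda>i. e (Suc i))) (e 0) | Suc j \<Rightarrow> e (Suc j)"
  have "computable (?G i)" for i
    by (cases i) (simp_all add: computable_code_nth computable_shift[OF c] computable_var)
  from computable_subst[OF P[unfolded computable_pred_def], of ?G, OF this]
  show "computable_pred (\<lambda>e. P (code_nth (c (\<lambda>i. e (Suc i))) (e 0)) (\<lambda>i. e (Suc i)))"
    by (simp add: computable_pred_def)
qed

lemma computable_pred_code_set_all [comp_intro]:
  assumes c: "computable c" and P: "computable_pred (\<lambda>e. P (e 0) (\<lambda>i. e (Suc i)))"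
  shows "computable_pred (\<lambda>e. code_set_all (c e) (\<lambda>z. P z e))"
  unfolding code_set_all_def
  by (intro computable_pred_ball computable_pred_imp computable_pred_set_decode computable_var
      c computable_shift[OF c] P)

lemma computable_pred_5:
  assumes "computable_pred (\<lambda>e. f (e 0) (e 1) (e 2) (e 3) (e 4))"
    "computable A" "computable B" "computable C" "computable D" "computable E"
  shows "computable_pred (\<lambda>e. f (A e) (B e) (C e) (D e) (E e))"
  using computable_subst[OF assms(1)[unfolded computable_pred_def],
      of "\<lambda>i. if i = 0 then A else if i = 1 then B else if i = 2 then C else if i = 3 then D else E"]
    assms
  by (simp add: computable_pred_def)

section \<open>The decision procedure\<close>

text \<open>The base-\<open>K\<close> digits of \<open>w\<close> represent a pair of valuations: \<open>digit K w s\<close> is the valuation for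
  the dependency number \<open>s\<close>.\<close>

definition digit :: "nat \<Rightarrow> nat \<Rightarrow> nat \<Rightarrow> nat \<Rightarrow> nat" where
  "digit K w s y = w div K ^ (2 * y + s) mod K"

definition body_code :: "nat \<Rightarrow> nat" where
  "body_code t = fst (prod_decode t)"

text \<open>For a head \<open>Triple(f(xs), p, ob) \<and> Ts(f(xs)) \<and> To(ob)\<close>, the terms \<open>f(xs)\<close>, \<open>p\<close>, \<open>ob\<close> are found at
  \<open>0 1\<close>, \<open>0 2\<close>, \<open>0 3\<close>, and the types \<open>Ts\<close>, \<open>To\<close> at \<open>1 1\<close>, \<open>2 1\<close>.\<close>

definition head_code :: "nat \<Rightarrow> nat \<Rightarrow> nat \<Rightarrow> nat" where
  "head_code t i j = code_nth (code_nth (snd (prod_decode t)) i) j"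

text \<open>A map is coded by its graph, so the constraints of the subject type are found by a
  search for \<open>h\<close>. The \<open>- 1\<close> undoes \<open>Suc\<close> in
  \<open>code_shape\<close>, and \<open>0\<close> and \<open>1\<close> are the codes of
  \<open>One\<close> and \<open>Opt\<close>.\<close>

definition code_contentious :: "nat \<Rightarrow> nat \<Rightarrow> nat \<Rightarrow> bool" where
  "code_contentious x t\<^sub>1 t\<^sub>2 \<longleftrightarrow>
     code_nth (head_code t\<^sub>1 0 1) 1 = code_nth (head_code t\<^sub>2 0 1) 1 \<and>
     head_code t\<^sub>1 0 2 = head_code t\<^sub>2 0 2 \<and>
     head_code t\<^sub>1 1 1 = head_code t\<^sub>2 1 1 \<and>
     head_code t\<^sub>1 2 1 = head_code t\<^sub>2 2 1 \<and>
     (\<exists>h<code_nth x 1. prod_encode (head_code t\<^sub>1 1 1 - 1, h) \<in> set_decode (code_nth x 1) \<and>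
       (\<exists>\<mu><2. list_encode [code_nth (head_code t\<^sub>1 0 2) 1, head_code t\<^sub>1 2 1, \<mu>] \<in> set_decode h))"

definition code_fd_consistent :: "nat \<Rightarrow> nat \<Rightarrow> nat \<Rightarrow> nat \<Rightarrow> nat \<Rightarrow> bool" where
  "code_fd_consistent x K w t\<^sub>1 t\<^sub>2 \<longleftrightarrow>
     (\<forall>s<2. \<forall>s'<2. code_list_all (body_code (if s = 0 then t\<^sub>1 else t\<^sub>2)) (\<lambda>a.
        code_list_all (body_code (if s' = 0 then t\<^sub>1 else t\<^sub>2)) (\<lambda>b.
        code_set_all (snd (prod_decode (code_nth x 0))) (\<lambda>d.
          fst (prod_decode a) = fst (prod_decode d) \<longrightarrow> fst (prod_decode b) = fst (prod_decode d) \<longrightarrow>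
          code_set_all (fst (prod_decode (snd (prod_decode d)))) (\<lambda>i.
            digit K w s (code_nth (snd (prod_decode a)) i) =
            digit K w s' (code_nth (snd (prod_decode b)) i)) \<longrightarrow>
          code_set_all (snd (prod_decode (snd (prod_decode d)))) (\<lambda>i.
            digit K w s (code_nth (snd (prod_decode a)) i) =
            digit K w s' (code_nth (snd (prod_decode b)) i))))))"

definition code_values_less :: "nat \<Rightarrow> nat \<Rightarrow> nat \<Rightarrow> nat \<Rightarrow> nat \<Rightarrow> bool" where
  "code_values_less m K w t\<^sub>1 t\<^sub>2 \<longleftrightarrow>
     (\<forall>s<2. code_list_all (body_code (if s = 0 then t\<^sub>1 else t\<^sub>2)) (\<lambda>a.
        code_list_all (snd (prod_decode a)) (\<lambda>y. digit K w s y < m)))"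

definition code_subjects_agree :: "nat \<Rightarrow> nat \<Rightarrow> nat \<Rightarrow> nat \<Rightarrow> bool" where
  "code_subjects_agree K w t\<^sub>1 t\<^sub>2 \<longleftrightarrow>
     (\<forall>k<code_length (code_nth (head_code t\<^sub>1 0 1) 2).
        digit K w 0 (code_nth (code_nth (head_code t\<^sub>1 0 1) 2) k) =
        digit K w 1 (code_nth (code_nth (head_code t\<^sub>2 0 1) 2) k))"

text \<open>Type code \<open>0\<close> is that of \<open>LitSym\<close>, which marks variable
  objects. Entry \<open>1\<close> of a term code is the variable or the constructor, entry
  \<open>2\<close> the argument list. \<open>Q\<close> tests the arguments and is the only part of
  the program in which the two halves of the theorem differ.\<close>

definition code_objects_agree ::
  "(nat \<Rightarrow> nat \<Rightarrow> nat \<Rightarrow> nat \<Rightarrow> nat \<Rightarrow> bool) \<Rightarrow> nat \<Rightarrow> nat \<Rightarrow> nat \<Rightarrow> nat \<Rightarrow> bool" where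
  "code_objects_agree Q K w t\<^sub>1 t\<^sub>2 \<longleftrightarrow>
     head_code t\<^sub>1 2 1 = 0 \<and>
       digit K w 0 (code_nth (head_code t\<^sub>1 0 3) 1) = digit K w 1 (code_nth (head_code t\<^sub>2 0 3) 1) \<or>
     head_code t\<^sub>1 2 1 \<noteq> 0 \<and>
       code_nth (head_code t\<^sub>1 0 3) 1 = code_nth (head_code t\<^sub>2 0 3) 1 \<and>
       Q K w (code_nth (head_code t\<^sub>1 0 3) 1)
         (code_nth (head_code t\<^sub>1 0 3) 2) (code_nth (head_code t\<^sub>2 0 3) 2)"

text \<open>\<open>K\<close> bounds both the number of labels that are needed and the positions of the relevant digits.\<close>

definition code_overlapping ::
  "bool \<Rightarrow> nat \<Rightarrow> (nat \<Rightarrow> nat \<Rightarrow> nat \<Rightarrow> nat \<Rightarrow> nat \<Rightarrow> bool) \<Rightarrow> nat \<Rightarrow> nat \<Rightarrow> nat \<Rightarrow> nat \<Rightarrow> bool" where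
  "code_overlapping fin m Q x K t\<^sub>1 t\<^sub>2 \<longleftrightarrow>
     (\<forall>w<K ^ K. (fin \<longrightarrow> code_values_less m K w t\<^sub>1 t\<^sub>2) \<longrightarrow> code_fd_consistent x K w t\<^sub>1 t\<^sub>2 \<longrightarrow>
        code_subjects_agree K w t\<^sub>1 t\<^sub>2 \<longrightarrow> code_objects_agree Q K w t\<^sub>1 t\<^sub>2)"

text \<open>Variables are smaller than \<open>x\<close>, so two bodies have at most
  \<open>2 * x\<close> of them, and digit positions \<open>2 * y + s\<close> with
  \<open>s < 2\<close> stay below \<open>2 * x\<close>; the summand \<open>2\<close> keeps the base
  positive.\<close>

definition code_key_covered ::
  "bool \<Rightarrow> nat \<Rightarrow> (nat \<Rightarrow> nat \<Rightarrow> nat \<Rightarrow> nat \<Rightarrow> nat \<Rightarrow> bool) \<Rightarrow> nat \<Rightarrow> bool" where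
  "code_key_covered fin m Q x \<longleftrightarrow>
     code_set_all (code_nth x 2) (\<lambda>t\<^sub>1. code_set_all (code_nth x 2) (\<lambda>t\<^sub>2.
       code_contentious x t\<^sub>1 t\<^sub>2 \<longrightarrow> code_overlapping fin m Q x (2 * x + 2) t\<^sub>1 t\<^sub>2))"

lemma computable_code_key_covered:
  assumes "computable_pred (\<lambda>e. Q (e 0) (e 1) (e 2) (e 3) (e 4))"
  shows "computable_pred (\<lambda>e. code_key_covered fin m Q (e 0))"
  unfolding code_key_covered_def code_overlapping_def code_objects_agree_def
    code_subjects_agree_def code_values_less_def code_fd_consistent_def code_contentious_def
    head_code_def body_code_def digit_def list_encode.simps
  by (intro comp_intro computable_pred_5[OF assms])

section \<open>Decoding the code of a setting\<close>

lemma body_code_code_tgd: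
  "body_code (code_tgd e \<sigma>) = list_encode (map (\<lambda>(R, xs). prod_encode (R, list_encode xs)) (body \<sigma>))"
  by (cases \<sigma>) (simp add: body_code_def)

lemma head_code_typed_head:
  assumes "head \<sigma> = typed_head f xs p ob Ts To"
  shows "head_code (code_tgd e \<sigma>) 0 (Suc 0) = list_encode [2, f, list_encode xs]"
    "head_code (code_tgd e \<sigma>) 0 2 = list_encode [1, e p]"
    "head_code (code_tgd e \<sigma>) 0 3 = code_trm e ob"
    "head_code (code_tgd e \<sigma>) (Suc 0) (Suc 0) = Suc Ts"
    "head_code (code_tgd e \<sigma>) 2 (Suc 0) = code_shape To"
  using assms by (cases \<sigma>; simp add: head_code_def typed_head_def del: list_encode.simps)+

lemma nth_codes_code_setting:
  "code_nth (code_setting e E) 0 = code_rel_schema (rel E)"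
  "code_nth (code_setting e E) (Suc 0) = code_shex_schema e (shex E)"
  "code_nth (code_setting e E) 2 = set_encode (code_tgd e ` tgds E)"
  by (simp_all add: code_setting_def del: list_encode.simps)

lemma mem_less_list_encode: "y \<in> set xs \<Longrightarrow> y < list_encode xs"
  by (induction xs) (auto simp: less_Suc_eq_le le_prod_encode_1 intro: le_trans[OF less_imp_le le_prod_encode_2])

lemma mem_less_set_encode: "finite A \<Longrightarrow> k \<in> A \<Longrightarrow> k < set_encode A"
  using mem_set_decode_less[of k "set_encode A"] by simp

text \<open>A pair is coded by at least each component, and list and set codes exceed their members,
  so the code bounds every number nested in it.\<close>

lemma body_vars_less_code_setting:
  assumes "finite (tgds E)" "\<sigma> \<in> tgds E" "y \<in> body_vars (body \<sigma>)"
  shows "y < code_setting e E"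
proof -
  obtain R xs where *: "(R, xs) \<in> set (body \<sigma>)" "y \<in> set xs"
    using assms(3) by (auto simp: body_vars_def)
  let ?a = "\<lambda>(R, xs). prod_encode (R, list_encode xs)"
  have "y < list_encode xs"
    using *(2) by (rule mem_less_list_encode)
  also have "\<dots> \<le> prod_encode (R, list_encode xs)"
    by (rule le_prod_encode_2)
  also have "\<dots> < list_encode (map ?a (body \<sigma>))"
    using *(1) by (intro mem_less_list_encode) force
  also have "\<dots> \<le> code_tgd e \<sigma>"
    by (cases \<sigma>) (simp add: le_prod_encode_1)
  also have "\<dots> < set_encode (code_tgd e ` tgds E)"
    using assms(1,2) by (intro mem_less_set_encode) auto
  also have "\<dots> < code_setting e E"
    unfolding code_setting_def by (intro mem_less_list_encode) simp
  finally show ?thesis .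
qed

lemma inj_code_shape: "code_shape S = code_shape T \<longleftrightarrow> S = T"
  by (cases S; cases T) auto

text \<open>Positions lie below the arity, which leaves finitely many possible dependencies. This is
  needed because \<open>set_encode\<close> is faithful only on finite sets.\<close>

lemma finite_fds:
  assumes "wf_rel_schema S" shows "finite (fds S)"
proof (rule finite_subset)
  let ?N = "\<Union>R\<in>rsyms S. {..<rarity S R}"
  show "fds S \<subseteq> rsyms S \<times> Pow ?N \<times> Pow ?N"
    using assms by (fastforce simp: wf_rel_schema_def)
  show "finite (rsyms S \<times> Pow ?N \<times> Pow ?N)"
    using assms by (auto simp: wf_rel_schema_def)
qed

lemma code_fd_consistent_iff:
  assumes S: "wf_rel_schema (rel E)" and \<phi>: "wf_bodies (rel E) (\<lambda>s. body (if s = 0 then \<sigma>\<^sub>1 else \<sigma>\<^sub>2))"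
  shows "code_fd_consistent (code_setting e E) K w (code_tgd e \<sigma>\<^sub>1) (code_tgd e \<sigma>\<^sub>2) \<longleftrightarrow>
    fd_consistent (rel E) (\<lambda>s. body (if s = 0 then \<sigma>\<^sub>1 else \<sigma>\<^sub>2)) (digit K w)"
proof -
  define \<psi> where "\<psi> = (\<lambda>s :: nat. body (if s = 0 then \<sigma>\<^sub>1 else \<sigma>\<^sub>2))"
  have b: "body_code (if s = 0 then code_tgd e \<sigma>\<^sub>1 else code_tgd e \<sigma>\<^sub>2) =
      list_encode (map (\<lambda>(R, xs). prod_encode (R, list_encode xs)) (\<psi> s))" for s :: nat
    by (simp add: body_code_code_tgd \<psi>_def)
  have F: "snd (prod_decode (code_nth (code_setting e E) 0)) = set_encode (code_fd ` fds (rel E))"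
    by (simp add: nth_codes_code_setting code_rel_schema_def)
  have fd: "code_set_all (fst (prod_decode (snd (prod_decode (code_fd d))))) P \<longleftrightarrow> (\<forall>i\<in>fst (snd d). P i)"
    "code_set_all (snd (prod_decode (snd (prod_decode (code_fd d))))) P \<longleftrightarrow> (\<forall>i\<in>snd (snd d). P i)"
    "fst (prod_decode (code_fd d)) = fst d"
    if "d \<in> fds (rel E)" for d P
  proof -
    have "fst (snd d) \<subseteq> {..<rarity (rel E) (fst d)}" "snd (snd d) \<subseteq> {..<rarity (rel E) (fst d)}"
      using S that by (cases d; auto simp: wf_rel_schema_def)+
    then have "finite (fst (snd d))" "finite (snd (snd d))"
      by (auto intro: finite_subset)
    then show "code_set_all (fst (prod_decode (snd (prod_decode (code_fd d))))) P \<longleftrightarrow> (\<forall>i\<in>fst (snd d). P i)"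
      "code_set_all (snd (prod_decode (snd (prod_decode (code_fd d))))) P \<longleftrightarrow> (\<forall>i\<in>snd (snd d). P i)"
      "fst (prod_decode (code_fd d)) = fst d"
      by (simp_all add: code_fd_def split_beta)
  qed
  \<comment> \<open>\<open>code_nth\<close> is known only inside the list, and positions of
    dependencies do lie below the arity. That bound depends on the atom and the dependency, so this
    rewriting comes after the decoding of the sets.\<close>
  have nth: "code_nth (list_encode xs) i = xs ! i"
    if "s < 2" "(R, xs) \<in> set (\<psi> s)" "(R, X, Y) \<in> fds (rel E)" "i \<in> X \<or> i \<in> Y" for s R xs X Y i
    using that fd_positions[OF S that(3,4)] \<phi> by (auto simp: wf_bodies_def \<psi>_def)
  have "code_fd_consistent (code_setting e E) K w (code_tgd e \<sigma>\<^sub>1) (code_tgd e \<sigma>\<^sub>2) \<longleftrightarrow>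
    (\<forall>s<2. \<forall>s'<2. \<forall>a\<in>set (\<psi> s). \<forall>b\<in>set (\<psi> s'). \<forall>d\<in>fds (rel E).
       fst a = fst d \<longrightarrow> fst b = fst d \<longrightarrow>
       (\<forall>i\<in>fst (snd d). digit K w s (code_nth (list_encode (snd a)) i) =
          digit K w s' (code_nth (list_encode (snd b)) i)) \<longrightarrow>
       (\<forall>i\<in>snd (snd d). digit K w s (code_nth (list_encode (snd a)) i) =
          digit K w s' (code_nth (list_encode (snd b)) i)))"
    unfolding code_fd_consistent_def b F
    by (simp add: finite_fds[OF S] fd split_beta del: list_encode.simps code_nth_list_encode cong: ball_cong)
  also have "\<dots> \<longleftrightarrow> (\<forall>s<2. \<forall>s'<2. \<forall>R xs ys X Y. (R, xs) \<in> set (\<psi> s) \<longrightarrow> (R, ys) \<in> set (\<psi> s') \<longrightarrow>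
        (R, X, Y) \<in> fds (rel E) \<longrightarrow>
        (\<forall>i\<in>X. digit K w s (code_nth (list_encode xs) i) = digit K w s' (code_nth (list_encode ys) i)) \<longrightarrow>
        (\<forall>i\<in>Y. digit K w s (code_nth (list_encode xs) i) = digit K w s' (code_nth (list_encode ys) i)))"
    unfolding Ball_def split_paired_All fst_conv snd_conv by (intro iffI allI impI; blast)
  also have "\<dots> \<longleftrightarrow> fd_consistent (rel E) \<psi> (digit K w)"
    unfolding fd_consistent_def using nth by (intro all_cong1 imp_cong refl ball_cong) auto
  finally show ?thesis
    unfolding \<psi>_def .
qed

section \<open>Correctness of the decision procedure\<close>

lemma typed_head_inject:
  "typed_head f xs p ob Ts To = typed_head f' xs' p' ob' Ts' To' \<longleftrightarrow>
     f = f' \<and> xs = xs' \<and> p = p' \<and> ob = ob' \<and> Ts = Ts' \<and> To = To'"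
  by (auto simp: typed_head_def)

lemma fully_typed_head:
  assumes "fully_typed D E" "\<sigma> \<in> tgds E"
  shows "\<exists>f xs p ob Ts To. head \<sigma> = typed_head f xs p ob Ts To \<and>
    ((\<exists>g zs T. ob = App g zs \<and> To = Shape T) \<or> (\<exists>z. ob = Var z \<and> To = LitSym))"
  using assms unfolding fully_typed_def by blast

lemma fully_typed_headD:
  assumes E: "fully_typed D E" "\<sigma> \<in> tgds E" and head: "head \<sigma> = typed_head f xs p ob Ts To"
  shows "length xs = farity (constructors E) f" "set xs \<subseteq> body_vars (body \<sigma>)"
    "wf_trm (constructors E) ob" "trm_vars ob \<subseteq> body_vars (body \<sigma>)" "Ts \<in> types (shex E)"
    "(\<exists>g zs T. ob = App g zs \<and> To = Shape T) \<or> (\<exists>z. ob = Var z \<and> To = LitSym)"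
proof -
  have wf: "wf_tgd (rel E) (shex E) (constructors E) \<sigma>"
    using E by (auto simp: fully_typed_def data_exchange_setting_def)
  have in_head: "Triple (App f xs) (Const p) ob \<in> set (head \<sigma>)" "Typed (Shape Ts) (App f xs) \<in> set (head \<sigma>)"
    by (simp_all add: head typed_head_def)
  then have "Shape Ts \<in> shapes (shex E)"
    using wf unfolding wf_tgd_def by blast
  then show "Ts \<in> types (shex E)"
    by (auto simp: shapes_def)
  have "\<forall>t\<in>atom_trms (Triple (App f xs) (Const p) ob).
      wf_trm (constructors E) t \<and> trm_vars t \<subseteq> body_vars (body \<sigma>)"
    using wf in_head(1) unfolding wf_tgd_def by blast
  then show "length xs = farity (constructors E) f" "set xs \<subseteq> body_vars (body \<sigma>)"
    "wf_trm (constructors E) ob" "trm_vars ob \<subseteq> body_vars (body \<sigma>)"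
    by (simp_all add: wf_trm_def)
  show "(\<exists>g zs T. ob = App g zs \<and> To = Shape T) \<or> (\<exists>z. ob = Var z \<and> To = LitSym)"
    using fully_typed_head[OF E] by (simp only: head typed_head_inject) blast
qed

text \<open>Both heads have the fully typed shape, so each comparison of codes compares one of their
  components; for predicates this needs \<open>e\<close> to be injective.\<close>

lemma code_contentious_iff:
  assumes E: "fully_typed D E" and e: "inj e" and \<sigma>: "\<sigma>\<^sub>1 \<in> tgds E" "\<sigma>\<^sub>2 \<in> tgds E"
  shows "code_contentious (code_setting e E) (code_tgd e \<sigma>\<^sub>1) (code_tgd e \<sigma>\<^sub>2) \<longleftrightarrow> contentious E \<sigma>\<^sub>1 \<sigma>\<^sub>2"
proof -
  obtain f xs p ob Ts To where h1: "head \<sigma>\<^sub>1 = typed_head f xs p ob Ts To"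
    using fully_typed_head[OF E \<sigma>(1)] by blast
  obtain f' xs' p' ob' Ts' To' where h2: "head \<sigma>\<^sub>2 = typed_head f' xs' p' ob' Ts' To'"
    using fully_typed_head[OF E \<sigma>(2)] by blast
  have wf: "wf_shex_schema D (shex E)"
    using E by (simp add: fully_typed_def data_exchange_setting_def)
  have Ts: "Ts \<in> types (shex E)"
    by (rule fully_typed_headD[OF E \<sigma>(1) h1])
  let ?h = "\<lambda>T. set_encode (code_triple_constraint e ` delta (shex E) T)"
  have fin: "finite (types (shex E))" "finite (delta (shex E) Ts)"
    using wf Ts by (auto simp: wf_shex_schema_def)
  let ?A = "(\<lambda>T. prod_encode (T, ?h T)) ` types (shex E)"
  have X: "code_nth (code_setting e E) (Suc 0) = set_encode ?A"
    by (simp add: nth_codes_code_setting code_shex_schema_def code_map_def)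
  have "?h Ts < set_encode ?A"
  proof -
    have "?h Ts \<le> prod_encode (Ts, ?h Ts)"
      by (rule le_prod_encode_2)
    also have "\<dots> < set_encode ?A"
      using fin Ts by (intro mem_less_set_encode) auto
    finally show ?thesis .
  qed
  \<comment> \<open>The graph has a single pair with first component \<open>Ts\<close>, so the
    search for \<open>h\<close> can find only \<open>?h Ts\<close>.\<close>
  then have 1: "(\<exists>h<set_encode ?A. prod_encode (Ts, h) \<in> set_decode (set_encode ?A) \<and> P h) \<longleftrightarrow> P (?h Ts)" for P
    using fin(1) Ts by (auto simp: prod_encode_eq)
  have 2: "list_encode [e p, code_shape To, k] \<in> set_decode (?h Ts) \<longleftrightarrow>
      (\<exists>\<mu>. TC p To \<mu> \<in> delta (shex E) Ts \<and> code_mult \<mu> = k)" for k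
  proof -
    have *: "list_encode [e p, code_shape To, k] = code_triple_constraint e c \<longleftrightarrow>
        (\<exists>\<mu>. c = TC p To \<mu> \<and> code_mult \<mu> = k)" for c
      using e by (cases c) (auto simp: inj_code_shape inj_eq list_encode_eq simp del: list_encode.simps)
    have "list_encode [e p, code_shape To, k] \<in> set_decode (?h Ts) \<longleftrightarrow>
        (\<exists>c\<in>delta (shex E) Ts. list_encode [e p, code_shape To, k] = code_triple_constraint e c)"
      using fin(2) by (simp add: image_iff del: list_encode.simps)
    then show ?thesis
      unfolding * by blast
  qed
  have 3: "code_mult \<mu> < 2 \<longleftrightarrow> \<mu> \<in> {One, Opt}" for \<mu>
    by (cases \<mu>) auto
  have "code_contentious (code_setting e E) (code_tgd e \<sigma>\<^sub>1) (code_tgd e \<sigma>\<^sub>2) \<longleftrightarrow>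
      f = f' \<and> p = p' \<and> Ts = Ts' \<and> To = To' \<and> (\<exists>k<2. list_encode [e p, code_shape To, k] \<in> set_decode (?h Ts))"
    using e unfolding code_contentious_def
    by (simp add: head_code_typed_head[OF h1] head_code_typed_head[OF h2] X 1 inj_code_shape inj_eq
        list_encode_eq del: list_encode.simps)
  also have "\<dots> \<longleftrightarrow> contentious E \<sigma>\<^sub>1 \<sigma>\<^sub>2"
    unfolding contentious_def h1 h2 typed_head_inject 2 using 3 by metis
  finally show ?thesis .
qed

lemma functionally_overlapping_iff:
  assumes "head \<sigma>\<^sub>1 = typed_head f xs\<^sub>1 p o\<^sub>1 Ts To" "head \<sigma>\<^sub>2 = typed_head f xs\<^sub>2 p o\<^sub>2 Ts To"
  shows "functionally_overlapping D E \<sigma>\<^sub>1 \<sigma>\<^sub>2 \<longleftrightarrow>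
    (\<forall>I v. valid_instance D (rel E) I \<longrightarrow>
       (\<forall>s<2. sat_body I (v s) (body (if s = 0 then \<sigma>\<^sub>1 else \<sigma>\<^sub>2))) \<longrightarrow>
       map (v 0) xs\<^sub>1 = map (v 1) xs\<^sub>2 \<longrightarrow>
       eval_trm (Fint (constructors E)) (v 0) o\<^sub>1 = eval_trm (Fint (constructors E)) (v (1::nat)) o\<^sub>2)"
    (is "?L \<longleftrightarrow> ?R")
proof
  assume L: ?L
  show ?R
  proof (intro allI impI)
    fix I and v :: "nat \<Rightarrow> nat \<Rightarrow> 'a"
    assume I: "valid_instance D (rel E) I"
      and sat: "\<forall>s<2. sat_body I (v s) (body (if s = 0 then \<sigma>\<^sub>1 else \<sigma>\<^sub>2))"
      and eq: "map (v 0) xs\<^sub>1 = map (v 1) xs\<^sub>2"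
    have "sat_body I (v 0) (body \<sigma>\<^sub>1)" "sat_body I (v 1) (body \<sigma>\<^sub>2)"
      using sat[rule_format, of 0] sat[rule_format, of 1] by simp_all
    with L I eq assms
    show "eval_trm (Fint (constructors E)) (v 0) o\<^sub>1 = eval_trm (Fint (constructors E)) (v 1) o\<^sub>2"
      unfolding functionally_overlapping_def by blast
  qed
next
  assume R: ?R
  show ?L
    unfolding functionally_overlapping_def assms typed_head_inject
  proof (clarify)
    fix I v\<^sub>1 v\<^sub>2
    assume "valid_instance D (rel E) I" "sat_body I v\<^sub>1 (body \<sigma>\<^sub>1)" "sat_body I v\<^sub>2 (body \<sigma>\<^sub>2)"
      "map v\<^sub>1 xs\<^sub>1 = map v\<^sub>2 xs\<^sub>2"
    then show "eval_trm (Fint (constructors E)) v\<^sub>1 o\<^sub>1 = eval_trm (Fint (constructors E)) v\<^sub>2 o\<^sub>2"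
      using R[rule_format, of I "\<lambda>s. if s = 0 then v\<^sub>1 else v\<^sub>2"] by simp
  qed
qed

lemma objects_agree_cong:
  assumes "\<And>y. y \<in> trm_vars o\<^sub>1 \<Longrightarrow> v 0 y = v' 0 y" "\<And>y. y \<in> trm_vars o\<^sub>2 \<Longrightarrow> v 1 y = v' 1 y"
  shows "objects_agree G v o\<^sub>1 o\<^sub>2 \<longleftrightarrow> objects_agree G v' o\<^sub>1 o\<^sub>2"
  using assms by (cases o\<^sub>1; cases o\<^sub>2) (auto cong: map_cong)

lemma code_overlapping_iff:
  assumes E: "fully_typed D E" and \<sigma>: "\<sigma>\<^sub>1 \<in> tgds E" "\<sigma>\<^sub>2 \<in> tgds E"
    and h1: "head \<sigma>\<^sub>1 = typed_head f xs\<^sub>1 p o\<^sub>1 Ts To" and h2: "head \<sigma>\<^sub>2 = typed_head f xs\<^sub>2 p o\<^sub>2 Ts To"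
    and G: "decides_equality D (constructors E) G"
    and Q: "\<And>K w g ys zs. Q K w g (list_encode ys) (list_encode zs) \<longleftrightarrow>
      G g (map (digit K w 0) ys) (map (digit K w 1) zs)"
    and K: "K = 2 * code_setting e E + 2"
  shows "code_overlapping (finite (constants D)) (card (constants D)) Q (code_setting e E) K
      (code_tgd e \<sigma>\<^sub>1) (code_tgd e \<sigma>\<^sub>2) \<longleftrightarrow> functionally_overlapping D E \<sigma>\<^sub>1 \<sigma>\<^sub>2"
proof -
  let ?x = "code_setting e E" and ?M = "constants D" and ?J = "Fint (constructors E)"
  let ?\<phi> = "\<lambda>s :: nat. body (if s = 0 then \<sigma>\<^sub>1 else \<sigma>\<^sub>2)"
  let ?xs = "\<lambda>s :: nat. if s = 0 then xs\<^sub>1 else xs\<^sub>2" and ?o = "\<lambda>s :: nat. if s = 0 then o\<^sub>1 else o\<^sub>2"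
  note H1 = fully_typed_headD[OF E \<sigma>(1) h1] and H2 = fully_typed_headD[OF E \<sigma>(2) h2]
  have set: "data_exchange_setting D E"
    using E by (simp add: fully_typed_def)
  have S: "wf_rel_schema (rel E)" and C: "wf_iri_constructors D (constructors E)"
    and fin: "finite (tgds E)"
    using set by (auto simp: data_exchange_setting_def)
  have "wf_tgd (rel E) (shex E) (constructors E) (if s = 0 then \<sigma>\<^sub>1 else \<sigma>\<^sub>2)" for s :: nat
    using set \<sigma> by (auto simp: data_exchange_setting_def)
  then have \<phi>: "wf_bodies (rel E) ?\<phi>"
    unfolding wf_bodies_def wf_tgd_def by fast
  have vars: "y < ?x" if "y \<in> body_vars (?\<phi> s)" for s y
    using body_vars_less_code_setting[OF fin _ that] \<sigma> by (auto split: if_splits)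
  then have card: "card (body_vars (?\<phi> s)) \<le> ?x" for s
    using card_mono[of "{..<?x}" "body_vars (?\<phi> s)"] by fastforce
  define OK where "OK = (\<lambda>v. (finite ?M \<longrightarrow> body_values ?\<phi> v \<subseteq> {..<card ?M}) \<longrightarrow>
      fd_consistent (rel E) ?\<phi> v \<longrightarrow> map (v 0) xs\<^sub>1 = map (v 1) xs\<^sub>2 \<longrightarrow> objects_agree G v o\<^sub>1 o\<^sub>2)"
  \<comment> \<open>A number below \<open>K ^ K\<close> has only \<open>K\<close> digits and cannot
    represent arbitrary labels of all variables; it is therefore essential that \<open>OK\<close>
    depends on the body variables alone.\<close>
  have OK_cong: "OK v \<longleftrightarrow> OK v'"
    if eq: "\<And>s y. s < 2 \<Longrightarrow> y \<in> body_vars (?\<phi> s) \<Longrightarrow> v s y = v' s y" for v v'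
  proof -
    have eq0: "v 0 y = v' 0 y" if "y \<in> body_vars (body \<sigma>\<^sub>1)" for y
      using eq[of 0 y] that by simp
    have eq1: "v 1 y = v' 1 y" if "y \<in> body_vars (body \<sigma>\<^sub>2)" for y
      using eq[of 1 y] that by simp
    have "body_values ?\<phi> v = body_values ?\<phi> v'"
      unfolding body_values_def using eq by (intro SUP_cong image_cong) auto
    moreover have "fd_consistent (rel E) ?\<phi> v \<longleftrightarrow> fd_consistent (rel E) ?\<phi> v'"
      using eq by (intro fd_consistent_relabel[OF S \<phi>, of "\<lambda>z. z"]) auto
    moreover have "map (v 0) xs\<^sub>1 = map (v' 0) xs\<^sub>1" "map (v 1) xs\<^sub>2 = map (v' 1) xs\<^sub>2"
      using eq0 eq1 H1(2) H2(2) by (auto intro!: map_cong)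
    moreover have "objects_agree G v o\<^sub>1 o\<^sub>2 \<longleftrightarrow> objects_agree G v' o\<^sub>1 o\<^sub>2"
      using eq0 eq1 H1(4) H2(4) by (intro objects_agree_cong) auto
    ultimately show ?thesis
      unfolding OK_def by (simp only:)
  qed
  have "functionally_overlapping D E \<sigma>\<^sub>1 \<sigma>\<^sub>2 \<longleftrightarrow>
     (\<forall>I v. valid_instance D (rel E) I \<longrightarrow> (\<forall>s<2. sat_body I (v s) (?\<phi> s)) \<longrightarrow>
        map (v 0) (?xs 0) = map (v 1) (?xs 1) \<longrightarrow>
        eval_trm ?J (v 0) (?o 0) = eval_trm ?J (v 1) (?o 1))"
    by (simp add: functionally_overlapping_iff[OF h1 h2])
  also have "\<dots> \<longleftrightarrow> (\<forall>v. (\<forall>s y. v s y < K) \<longrightarrow>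
           (finite ?M \<longrightarrow> body_values ?\<phi> v \<subseteq> {..<card ?M}) \<longrightarrow>
           fd_consistent (rel E) ?\<phi> v \<longrightarrow> map (v 0) (?xs 0) = map (v 1) (?xs 1) \<longrightarrow>
           (\<forall>u. inj_on u (body_values ?\<phi> v) \<longrightarrow> u ` body_values ?\<phi> v \<subseteq> ?M \<longrightarrow>
              eval_trm ?J (\<lambda>y. u (v 0 y)) (?o 0) = eval_trm ?J (\<lambda>y. u (v 1 y)) (?o 1)))"
    using card[of 0] card[of 1] H1(2,4) H2(2,4) K
    by (intro overlap_iff_relabelled[OF S \<phi>]) auto
  also have "\<dots> \<longleftrightarrow> (\<forall>v. (\<forall>s y. v s y < K) \<longrightarrow> OK v)"
  proof -
    \<comment> \<open>This is where the filter on labels is used: without it there might be no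
      \<open>u\<close>, and the left side would hold vacuously.\<close>
    have "(\<forall>u. inj_on u (body_values ?\<phi> v) \<longrightarrow> u ` body_values ?\<phi> v \<subseteq> ?M \<longrightarrow>
              eval_trm ?J (\<lambda>y. u (v 0 y)) o\<^sub>1 = eval_trm ?J (\<lambda>y. u (v 1 y)) o\<^sub>2)
        \<longleftrightarrow> objects_agree G v o\<^sub>1 o\<^sub>2"
      if fit: "finite ?M \<longrightarrow> body_values ?\<phi> v \<subseteq> {..<card ?M}" for v
    proof (rule objects_agree_iff[OF C G H1(3) H2(3)])
      show "(\<exists>y z. o\<^sub>1 = Var y \<and> o\<^sub>2 = Var z) \<or> (\<exists>f ys g zs. o\<^sub>1 = App f ys \<and> o\<^sub>2 = App g zs)"
        using H1(6) H2(6) by auto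
      show "card (body_values ?\<phi> v) \<le> card ?M" if "finite ?M"
        using fit that card_mono[of "{..<card ?M}" "body_values ?\<phi> v"] by simp
      show "v 0 ` trm_vars o\<^sub>1 \<subseteq> body_values ?\<phi> v" "v 1 ` trm_vars o\<^sub>2 \<subseteq> body_values ?\<phi> v"
        using H1(4) H2(4) body_valuesI[of 0 _ ?\<phi> v] body_valuesI[of 1 _ ?\<phi> v] by auto
    qed (rule finite_body_values)
    then show ?thesis
      unfolding OK_def by simp
  qed
  also have "\<dots> \<longleftrightarrow> (\<forall>w<K ^ K. OK (digit K w))"
  proof
    assume "\<forall>v. (\<forall>s y. v s y < K) \<longrightarrow> OK v"
    then show "\<forall>w<K ^ K. OK (digit K w)"
      using K by (simp add: digit_def)
  next
    assume R: "\<forall>w<K ^ K. OK (digit K w)"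
    show "\<forall>v. (\<forall>s y. v s y < K) \<longrightarrow> OK v"
    proof (intro allI impI)
      fix v :: "nat \<Rightarrow> nat \<Rightarrow> nat"
      assume "\<forall>s y. v s y < K"
      then obtain w where w: "w < K ^ K" "\<And>i. i < K \<Longrightarrow> w div K ^ i mod K = v (i mod 2) (i div 2)"
        using ex_digits[of "\<lambda>i. v (i mod 2) (i div 2)" K K] by auto
      have "v s y = digit K w s y" if "s < 2" "y \<in> body_vars (?\<phi> s)" for s y
        using w(2)[of "2 * y + s"] vars[OF that(2)] that(1) K by (simp add: digit_def)
      then show "OK v"
        using OK_cong R w(1) by metis
    qed
  qed
  also have "\<dots> \<longleftrightarrow> code_overlapping (finite ?M) (card ?M) Q ?x K (code_tgd e \<sigma>\<^sub>1) (code_tgd e \<sigma>\<^sub>2)"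
  proof -
    have vals: "code_values_less m K w (code_tgd e \<sigma>\<^sub>1) (code_tgd e \<sigma>\<^sub>2) \<longleftrightarrow>
        body_values ?\<phi> (digit K w) \<subseteq> {..<m}" for m w
    proof -
      have b: "body_code (if s = 0 then code_tgd e \<sigma>\<^sub>1 else code_tgd e \<sigma>\<^sub>2) =
          list_encode (map (\<lambda>(R, xs). prod_encode (R, list_encode xs)) (?\<phi> s))" for s :: nat
        by (simp add: body_code_code_tgd)
      have "code_list_all (list_encode (map (\<lambda>(R, xs). prod_encode (R, list_encode xs)) \<psi>))
          (\<lambda>a. code_list_all (snd (prod_decode a)) P) \<longleftrightarrow> (\<forall>y\<in>body_vars \<psi>. P y)" for \<psi> P
        by (auto simp: body_vars_def split_beta simp del: list_encode.simps)
      then show ?thesis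
        unfolding code_values_less_def b body_values_def by (simp only:) blast
    qed
    have subjects: "code_subjects_agree K w (code_tgd e \<sigma>\<^sub>1) (code_tgd e \<sigma>\<^sub>2) \<longleftrightarrow>
        map (digit K w 0) xs\<^sub>1 = map (digit K w 1) xs\<^sub>2" for w
      unfolding code_subjects_agree_def One_nat_def head_code_typed_head[OF h1] head_code_typed_head[OF h2]
      using H1(1) H2(1) by (simp add: list_eq_iff_nth_eq del: list_encode.simps)
    have objects: "code_objects_agree Q K w (code_tgd e \<sigma>\<^sub>1) (code_tgd e \<sigma>\<^sub>2) \<longleftrightarrow>
        objects_agree G (digit K w) o\<^sub>1 o\<^sub>2" for w
      using H1(6) H2(6)
      by (auto simp: code_objects_agree_def head_code_typed_head[OF h1] head_code_typed_head[OF h2] Q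
          simp del: list_encode.simps)
    show ?thesis
      unfolding code_overlapping_def OK_def vals subjects objects code_fd_consistent_iff[OF S \<phi>] ..
  qed
  finally show ?thesis ..
qed

lemma code_key_covered_iff:
  assumes E: "fully_typed D E" and e: "inj e"
    and G: "decides_equality D (constructors E) G"
    and Q: "\<And>K w g ys zs. Q K w g (list_encode ys) (list_encode zs) \<longleftrightarrow>
      G g (map (digit K w 0) ys) (map (digit K w 1) zs)"
  shows "code_key_covered (finite (constants D)) (card (constants D)) Q (code_setting e E) \<longleftrightarrow>
    key_covered D E"
proof -
  have fin: "finite (tgds E)"
    using E by (auto simp: fully_typed_def data_exchange_setting_def)
  have "code_overlapping (finite (constants D)) (card (constants D)) Q (code_setting e E)
      (2 * code_setting e E + 2) (code_tgd e \<sigma>\<^sub>1) (code_tgd e \<sigma>\<^sub>2) \<longleftrightarrow> functionally_overlapping D E \<sigma>\<^sub>1 \<sigma>\<^sub>2"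
    if "\<sigma>\<^sub>1 \<in> tgds E" "\<sigma>\<^sub>2 \<in> tgds E" "contentious E \<sigma>\<^sub>1 \<sigma>\<^sub>2" for \<sigma>\<^sub>1 \<sigma>\<^sub>2
    using that(3) code_overlapping_iff[OF E that(1,2) _ _ G Q refl] unfolding contentious_def by blast
  then show ?thesis
    unfolding code_key_covered_def key_covered_def nth_codes_code_setting
    using fin code_contentious_iff[OF E e] by simp
qed

text \<open>\<open>G\<close> is the test on tuples of labels, \<open>Q\<close> its computable
  counterpart on codes. One \<open>Q\<close> has to serve all settings in \<open>A\<close>, which is
  what limits the choice of \<open>A\<close>.\<close>

lemma decidable_on_key_covered:
  assumes e: "inj e" and comp: "computable_pred (\<lambda>e. Q (e 0) (e 1) (e 2) (e 3) (e 4))"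
    and A: "\<And>E. E \<in> A \<Longrightarrow> fully_typed D E" "\<And>E. E \<in> A \<Longrightarrow> decides_equality D (constructors E) G"
    and Q: "\<And>K w g ys zs. Q K w g (list_encode ys) (list_encode zs) \<longleftrightarrow>
      G g (map (digit K w 0) ys) (map (digit K w 1) zs)"
  shows "decidable_on (code_setting e) A (key_covered D)"
proof -
  let ?P = "code_key_covered (finite (constants D)) (card (constants D)) Q"
  obtain d where "recursive 1 d" "\<And>x. d [x] = of_bool (?P x)"
    using computable_decides[OF computable_code_key_covered[OF comp, unfolded computable_pred_def]]
    by blast
  then show ?thesis
    unfolding decidable_on_def using code_key_covered_iff[OF A(1) e A(2) Q] by auto
qed

section \<open>Equality of object terms\<close>

definition same_kernel :: "'a list \<Rightarrow> 'b list \<Rightarrow> bool" where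
  "same_kernel a l \<longleftrightarrow> length a = length l \<and>
     (\<forall>i<length l. \<forall>j<length l. a ! i = a ! j \<longleftrightarrow> l ! i = l ! j)"

text \<open>\<open>h\<close> sends a value to the entry of \<open>l\<close> at a position where
  \<open>a\<close> has that value. Equality of kernels makes the chosen position immaterial and
  \<open>h\<close> injective.\<close>

lemma same_kernel_imp_map:
  assumes "same_kernel a l"
  shows "\<exists>h. inj_on h (set a) \<and> l = map h a"
proof (intro exI conjI)
  define h where "h x = l ! (SOME i. i < length a \<and> a ! i = x)" for x
  have h: "h (a ! i) = l ! i" if i: "i < length a" for i
  proof -
    have "(SOME j. j < length a \<and> a ! j = a ! i) < length a \<and> a ! (SOME j. j < length a \<and> a ! j = a ! i) = a ! i"
      using i by (intro someI[of "\<lambda>j. j < length a \<and> a ! j = a ! i" i]) simp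
    then show ?thesis
      using assms i unfolding h_def same_kernel_def by metis
  qed
  show "l = map h a"
    using assms h by (intro nth_equalityI) (auto simp: same_kernel_def)
  show "inj_on h (set a)"
    using assms h by (auto simp: inj_on_def in_set_conv_nth same_kernel_def)
qed

lemma same_kernel_map: "inj_on h (set a) \<Longrightarrow> same_kernel a (map h a)"
  by (auto simp: same_kernel_def inj_on_def)

text \<open>Numbering the distinct entries gives a representative with entries below the length;
  this is what makes the number of kernels finite.\<close>

lemma ex_small_same_kernel: "\<exists>l. set l \<subseteq> {..<length a} \<and> same_kernel a (l :: nat list)"
proof -
  obtain h where h: "bij_betw h (set a) {..<card (set a)}"
    using ex_bij_betw_finite_nat[of "set a"] atLeast0LessThan by (metis List.finite_set)
  have "h ` set a \<subseteq> {..<length a}"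
    using h card_length[of a] by (auto simp: bij_betw_def)
  then show ?thesis
    using same_kernel_map[of h a] h by (intro exI[of _ "map h a"]) (auto simp: bij_betw_def)
qed

definition interpretation_agrees ::
  "'d rdf_domain \<Rightarrow> 'd iri_constructors \<Rightarrow> nat \<Rightarrow> 'a list \<Rightarrow> bool" where
  "interpretation_agrees D C f l \<longleftrightarrow>
     (\<forall>u. inj_on u (set l) \<longrightarrow> u ` set l \<subseteq> constants D \<longrightarrow>
        Fint C f (map u (take (farity C f) l)) = Fint C f (map u (drop (farity C f) l)))"

text \<open>An interpretation of the entries of \<open>a\<close> is carried over to \<open>l\<close>
  along the inverse of the injection. As \<open>same_kernel\<close> is symmetric, the converse is an
  instance as well.\<close>

lemma interpretation_agrees_mono:
  assumes "same_kernel a l" "interpretation_agrees D C f l"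
  shows "interpretation_agrees D C f a"
  unfolding interpretation_agrees_def
proof (intro allI impI)
  fix u
  assume u: "inj_on u (set a)" "u ` set a \<subseteq> constants D"
  obtain h where h: "inj_on h (set a)" "l = map h a"
    using same_kernel_imp_map[OF assms(1)] by blast
  let ?u = "\<lambda>z. u (inv_into (set a) h z)"
  have eq: "?u (h x) = u x" if "x \<in> set a" for x
    using h(1) that by simp
  have "inj_on ?u (set l)"
    using h u(1) by (auto simp: inj_on_def)
  moreover have "?u ` set l \<subseteq> constants D"
    using h u(2) by auto
  ultimately have "Fint C f (map ?u (take (farity C f) l)) = Fint C f (map ?u (drop (farity C f) l))"
    using assms(2) unfolding interpretation_agrees_def by blast
  moreover have "map ?u (take (farity C f) l) = map u (take (farity C f) a)"
    "map ?u (drop (farity C f) l) = map u (drop (farity C f) a)"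
    using eq by (auto simp: h(2) take_map drop_map dest: in_set_takeD in_set_dropD)
  ultimately show "Fint C f (map u (take (farity C f) a)) = Fint C f (map u (drop (farity C f) a))"
    by simp
qed

text \<open>The bound on entries is that of \<open>ex_small_same_kernel\<close> for two concatenated
  tuples. Truth of \<open>interpretation_agrees\<close> need not be computable: coding the table
  requires only that it is finite.\<close>

definition kernel_table :: "'d rdf_domain \<Rightarrow> 'd iri_constructors \<Rightarrow> (nat \<times> nat list) set" where
  "kernel_table D C = {(f, l). f \<in> fsyms C \<and> length l = 2 * farity C f \<and>
     set l \<subseteq> {..<2 * farity C f} \<and> interpretation_agrees D C f l}"

lemma finite_kernel_table:
  assumes "finite (fsyms C)" shows "finite (kernel_table D C)"
proof (rule finite_subset)
  show "kernel_table D C \<subseteq>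
      (SIGMA f:fsyms C. {l. set l \<subseteq> {..<2 * farity C f} \<and> length l = 2 * farity C f})"
    by (auto simp: kernel_table_def)
  show "finite (SIGMA f:fsyms C. {l. set l \<subseteq> {..<2 * farity C f} \<and> length l = 2 * farity C f})"
    using assms by (intro finite_SigmaI finite_lists_length_eq) auto
qed

lemma decides_equality_kernel_table:
  "decides_equality D C (\<lambda>f a b. \<exists>(g, l)\<in>kernel_table D C. g = f \<and> same_kernel (a @ b) l)"
  unfolding decides_equality_def
proof (intro ballI allI impI)
  fix f and a b :: "nat list"
  assume f: "f \<in> fsyms C" and len: "length a = farity C f" "length b = farity C f"
  have "(\<exists>(g, l)\<in>kernel_table D C. g = f \<and> same_kernel (a @ b) l) \<longleftrightarrow> interpretation_agrees D C f (a @ b)"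
  proof
    assume "\<exists>(g, l)\<in>kernel_table D C. g = f \<and> same_kernel (a @ b) l"
    then show "interpretation_agrees D C f (a @ b)"
      using interpretation_agrees_mono by (fastforce simp: kernel_table_def)
  next
    assume agr: "interpretation_agrees D C f (a @ b)"
    obtain l :: "nat list" where l: "set l \<subseteq> {..<length (a @ b)}" "same_kernel (a @ b) l"
      using ex_small_same_kernel by blast
    have "same_kernel l (a @ b)"
      using l(2) by (auto simp: same_kernel_def)
    then have "(f, l) \<in> kernel_table D C"
      using l f len interpretation_agrees_mono[OF _ agr]
      by (auto simp: kernel_table_def same_kernel_def mult_2)
    then show "\<exists>(g, l)\<in>kernel_table D C. g = f \<and> same_kernel (a @ b) l"
      using l(2) by blast
  qed
  then show "(\<exists>(g, l)\<in>kernel_table D C. g = f \<and> same_kernel (a @ b) l) \<longleftrightarrow>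
     (\<forall>u. inj_on u (set a \<union> set b) \<longrightarrow> u ` (set a \<union> set b) \<subseteq> constants D \<longrightarrow>
        Fint C f (map u a) = Fint C f (map u b))"
    using len by (simp add: interpretation_agrees_def)
qed

text \<open>An interpretation \<open>u\<close> exists by the bound on labels, and both
  \<open>u\<close> and \<open>Fint C f\<close> reflect equality. Without any \<open>u\<close> the
  condition to be decided would be vacuous.\<close>

lemma decides_equality_injective:
  assumes "injective_iri_constructors C"
  shows "decides_equality D C (\<lambda>f a b. a = b)"
  unfolding decides_equality_def
proof (intro ballI allI impI)
  fix f and a b :: "nat list"
  assume f: "f \<in> fsyms C" and len: "length a = farity C f" "length b = farity C f"
    and fit: "finite (constants D) \<longrightarrow> card (set a \<union> set b) \<le> card (constants D)"
  obtain u where u: "inj_on u (set a \<union> set b)" "u ` (set a \<union> set b) \<subseteq> constants D"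
    using ex_injection[of "set a \<union> set b" "constants D"] fit by auto
  have "a = b" if "Fint C f (map u a) = Fint C f (map u b)"
  proof -
    have "map u a = map u b"
      using assms f len that unfolding injective_iri_constructors_def
      by (intro inj_onD[of "Fint C f" "{t. length t = farity C f}"]) auto
    then show ?thesis
      using inj_on_map_eq_map[OF u(1)] by simp
  qed
  then show "a = b \<longleftrightarrow> (\<forall>u. inj_on u (set a \<union> set b) \<longrightarrow> u ` (set a \<union> set b) \<subseteq> constants D \<longrightarrow>
      Fint C f (map u a) = Fint C f (map u b))"
    using u by blast
qed

section \<open>Testing argument tuples on codes\<close>

definition code_lists_agree :: "nat \<Rightarrow> nat \<Rightarrow> nat \<Rightarrow> nat \<Rightarrow> nat \<Rightarrow> bool" where
  "code_lists_agree K w g ys zs \<longleftrightarrow> code_length ys = code_length zs \<and>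
     (\<forall>i<code_length ys. digit K w 0 (code_nth ys i) = digit K w 1 (code_nth zs i))"

definition code_append_nth :: "nat \<Rightarrow> nat \<Rightarrow> nat \<Rightarrow> nat \<Rightarrow> nat \<Rightarrow> nat" where
  "code_append_nth K w ys zs i =
     (if i < code_length ys then digit K w 0 (code_nth ys i)
      else digit K w 1 (code_nth zs (i - code_length ys)))"

text \<open>An existential quantifier over the coded table \<open>N\<close>, expressed by negating
  \<open>code_set_all\<close>, whose closure rule then applies.\<close>

definition code_in_table :: "nat \<Rightarrow> nat \<Rightarrow> nat \<Rightarrow> nat \<Rightarrow> nat \<Rightarrow> nat \<Rightarrow> bool" where
  "code_in_table N K w g ys zs \<longleftrightarrow> \<not> code_set_all N (\<lambda>c. \<not> (fst (prod_decode c) = g \<and>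
     code_length ys + code_length zs = code_length (snd (prod_decode c)) \<and>
     (\<forall>i<code_length (snd (prod_decode c)). \<forall>j<code_length (snd (prod_decode c)).
        code_append_nth K w ys zs i = code_append_nth K w ys zs j \<longleftrightarrow>
        code_nth (snd (prod_decode c)) i = code_nth (snd (prod_decode c)) j)))"

lemma code_append_nth_list_encode:
  "i < length ys + length zs \<Longrightarrow> code_append_nth K w (list_encode ys) (list_encode zs) i =
     (map (digit K w 0) ys @ map (digit K w 1) zs) ! i"
  by (auto simp: code_append_nth_def nth_append)

lemma code_in_table_iff:
  assumes "finite T"
  shows "code_in_table (set_encode ((\<lambda>(f, l). prod_encode (f, list_encode l)) ` T)) K w g
      (list_encode ys) (list_encode zs) \<longleftrightarrow>
    (\<exists>(f, l)\<in>T. f = g \<and> same_kernel (map (digit K w 0) ys @ map (digit K w 1) zs) l)"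
  using assms
  by (auto simp: code_in_table_def same_kernel_def split_beta code_append_nth_list_encode)

theorem theorem2:
  fixes D :: "'d rdf_domain" and e :: "'d \<Rightarrow> nat"
  assumes "rdf_domain D" and "bij e"
  shows "(\<forall>C. decidable_on (code_setting e) {E. fully_typed D E \<and> constructors E = C} (key_covered D))
    \<and> decidable_on (code_setting e)
        {E. fully_typed D E \<and> injective_iri_constructors (constructors E)} (key_covered D)"
proof (intro conjI allI)
  have e: "inj e"
    using assms(2) by (rule bij_is_inj)
  have "computable_pred (\<lambda>e. code_lists_agree (e 0) (e 1) (e 2) (e 3) (e 4))"
    unfolding code_lists_agree_def digit_def by (intro comp_intro)
  moreover have "code_lists_agree K w g (list_encode ys) (list_encode zs) \<longleftrightarrow>
      map (digit K w 0) ys = map (digit K w 1) zs" for K w g ys zs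
    by (auto simp: code_lists_agree_def list_eq_iff_nth_eq simp del: list_encode.simps)
  ultimately show "decidable_on (code_setting e)
      {E. fully_typed D E \<and> injective_iri_constructors (constructors E)} (key_covered D)"
    by (intro decidable_on_key_covered[OF e, of code_lists_agree _ D "\<lambda>f a b. a = b"])
      (auto simp: decides_equality_injective)
  fix C :: "'d iri_constructors"
  let ?T = "kernel_table D C"
  let ?N = "set_encode ((\<lambda>(f, l). prod_encode (f, list_encode l)) ` ?T)"
  show "decidable_on (code_setting e) {E. fully_typed D E \<and> constructors E = C} (key_covered D)"
  proof (cases "finite (fsyms C)")
    case True
    have "computable_pred (\<lambda>e. code_in_table ?N (e 0) (e 1) (e 2) (e 3) (e 4))"
      unfolding code_in_table_def code_append_nth_def digit_def by (intro comp_intro)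
    then show ?thesis
      using decides_equality_kernel_table[of D C] code_in_table_iff[OF finite_kernel_table[OF True]]
      by (intro decidable_on_key_covered[OF e, of "code_in_table ?N"]) auto
  next
    \<comment> \<open>Well-formed settings have finitely many constructors, so this class is empty
      and a constant function decides it.\<close>
    case False
    then have "{E. fully_typed D E \<and> constructors E = C} = {}"
      by (auto simp: fully_typed_def data_exchange_setting_def wf_iri_constructors_def)
    then show ?thesis
      unfolding decidable_on_def using recursive.zero by blast
  qed
qed

end
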